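(* Let $p$ be a prime, let $P(x) \in \mathbb{F}_p[x]$ be a nonconstant polynomial, and let $Q(x) \in \mathbb{F}_p[x]$ be good for irrational equidistribution. For every $r \in \mathbb{N}$ there exist $K = K(P,Q,r)\in\mathbb{N}$ and $c = c(P,Q,r) > 0$ such that for every $k \ge K$ and every $r$-coloring $\mathbb{F}_{p^k} = \bigcup_{i=1}^r C_i$, \[ \left| \{ (x,y,z) \in \mathbb{F}_{p^k}^3 : P(x)-P(y) = Q(z) \text{ and } \{x,y,z\}\subseteq C_i \text{ for some } i\in\{1,\dots,r\} \} \right| \ge c\,(p^k)^2. \]
   Context: Here $Q$ is regarded as an element of $(\mathbb{F}_p[t])[x]$ (constant coefficients). $\mathbb{F}_p((t^{-1}))$ is the field of formal Laurent series $\sum_{j\le N}c_jt^j$ over $\mathbb{F}_p$, and $\mathbb{F}_p((t^{-1}))/\mathbb{F}_p[t]$ is a compact group with Haar probability $m$. A Følner sequence in $\mathbb{F}_p[t]$ is a sequence of finite nonempty sets $\Phi_N$ with $|(\Phi_N+n)\triangle\Phi_N|/|\Phi_N|\to0$ for all $n$. A sequence $a:\mathbb{F}_p[t]\to\mathbb{F}_p((t^{-1}))$ is well-distributed mod $\mathbb{F}_p[t]$ if $\lim_N \frac{1}{|\Phi_N|}\sum_{n\in\Phi_N}g(a(n))=\int g\,dm$ for every continuous $g$ on $\mathbb{F}_p((t^{-1}))/\mathbb{F}_p[t]$ and every Følner sequence. $Q$ is good for irrational equidistribution if $(Q(n)\alpha)_{n\in\mathbb{F}_p[t]}$ is well-distributed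 mod $\mathbb{F}_p[t]$ for every $\alpha\in\mathbb{F}_p((t^{-1}))\setminus\mathbb{F}_p(t)$. *)

theory Defs
  imports
    "HOL-Algebra.Algebraic_Closure_Type"
    "Berlekamp_Zassenhaus.Finite_Field"
    "HOL-Computational_Algebra.Formal_Laurent_Series"
    "HOL-Probability.Probability"
begin

section \<open>Laurent series in $1/t$, polynomials and rational functions in $t$\<close>

text \<open>
  The field of series $\sum_{j \le N} c_j t^j$ is the type \<open>'a fls\<close> whose indeterminate
  \<open>fls_X\<close> stands for $1/t$; so \<open>fls_X_inv\<close> is $t$, and the coefficient of $t^j$ is
  \<open>fls_nth f (- j)\<close>. The topology is the metric topology that the library puts on \<open>'a fls\<close>,
  in which series are close if they agree up to a high power of \<open>fls_X\<close>.
\<close>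

definition laurent_of_poly :: "'a::comm_ring_1 poly \<Rightarrow> 'a fls" where
  "laurent_of_poly n = poly (map_poly fls_const n) fls_X_inv"

definition rational_laurent :: "'a::field fls set" where
  "rational_laurent = {laurent_of_poly a / laurent_of_poly b |a b. b \<noteq> 0}"

lemma fls_nth_laurent_of_poly:
  "fls_nth (laurent_of_poly n) j = (if j \<le> 0 then coeff n (nat (- j)) else 0)"
proof -
  have "fls_nth (laurent_of_poly n) j =
      (\<Sum>i\<le>degree n. fls_nth (fls_const (coeff n i) * fls_X_inv ^ i) j)"
    unfolding laurent_of_poly_def
    by (simp add: poly_altdef degree_map_poly coeff_map_poly fls_nth_sum)
  also have "\<dots> = (\<Sum>i\<le>degree n. if j = - int i then coeff n i else 0)"
    by (intro sum.cong refl) (auto simp: fls_X_inv_power_nth)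
  also have "\<dots> = (if j \<le> 0 then coeff n (nat (- j)) else 0)"
  proof (cases "j \<le> 0")
    case True
    then have "(\<Sum>i\<le>degree n. if j = - int i then coeff n i else 0) =
      (\<Sum>i\<le>degree n. if i = nat (- j) then coeff n i else 0)"
      by (intro sum.cong) auto
    also have "\<dots> = coeff n (nat (- j))"
      by (auto simp: sum.delta coeff_eq_0)
    finally show ?thesis using True by simp
  qed auto
  finally show ?thesis .
qed

lemma laurent_of_poly_0 [simp]: "laurent_of_poly 0 = 0"
  and laurent_of_poly_add: "laurent_of_poly (a + b) = laurent_of_poly a + laurent_of_poly b"
  and laurent_of_poly_diff: "laurent_of_poly (a - b) = laurent_of_poly a - laurent_of_poly b"
  and laurent_of_poly_minus: "laurent_of_poly (- a) = - laurent_of_poly a"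
  by (rule fls_eqI; simp add: fls_nth_laurent_of_poly)+

section \<open>The compact quotient group\<close>

quotient_type (overloaded) 'a laurent_torus =
  "'a::comm_ring_1 fls" / "\<lambda>f g. f - g \<in> range laurent_of_poly"
  morphisms rep_laurent_torus to_torus
proof (rule equivpI)
  show "reflp (\<lambda>f g :: 'a fls. f - g \<in> range laurent_of_poly)"
    by (auto intro!: reflpI range_eqI[of _ _ 0])
  show "symp (\<lambda>f g :: 'a fls. f - g \<in> range laurent_of_poly)"
    by (auto intro!: sympI) (metis laurent_of_poly_minus minus_diff_eq rangeI)
  show "transp (\<lambda>f g :: 'a fls. f - g \<in> range laurent_of_poly)"
  proof (rule transpI)
    fix f g h :: "'a fls"
    assume "f - g \<in> range laurent_of_poly" "g - h \<in> range laurent_of_poly"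
    then obtain a b where "f - g = laurent_of_poly a" "g - h = laurent_of_poly b" by auto
    then have "f - h = laurent_of_poly (a + b)"
      by (simp add: laurent_of_poly_add) (metis diff_add_cancel add_diff_eq)
    then show "f - h \<in> range laurent_of_poly" by simp
  qed
qed

instantiation laurent_torus :: (comm_ring_1) ab_group_add
begin

lift_definition zero_laurent_torus :: "'a laurent_torus" is 0 .

lift_definition plus_laurent_torus ::
  "'a laurent_torus \<Rightarrow> 'a laurent_torus \<Rightarrow> 'a laurent_torus" is "(+)"
proof -
  fix f f' g g' :: "'a fls"
  assume "f - f' \<in> range laurent_of_poly" "g - g' \<in> range laurent_of_poly"
  then obtain a b where "f - f' = laurent_of_poly a" "g - g' = laurent_of_poly b" by auto
  then have "f + g - (f' + g') = laurent_of_poly (a + b)"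
    by (simp add: laurent_of_poly_add algebra_simps)
  then show "f + g - (f' + g') \<in> range laurent_of_poly" by simp
qed

lift_definition uminus_laurent_torus :: "'a laurent_torus \<Rightarrow> 'a laurent_torus" is uminus
proof -
  fix f f' :: "'a fls"
  assume "f - f' \<in> range laurent_of_poly"
  then obtain a where "f - f' = laurent_of_poly a" by auto
  then have "- f - - f' = laurent_of_poly (- a)"
    by (simp add: laurent_of_poly_minus) (metis minus_diff_eq)
  then show "- f - - f' \<in> range laurent_of_poly" by simp
qed

definition minus_laurent_torus :: "'a laurent_torus \<Rightarrow> 'a laurent_torus \<Rightarrow> 'a laurent_torus" where
  "x - y = x + - (y :: 'a laurent_torus)"

instance
proof
  fix a b c :: "'a laurent_torus"
  have z: "(0 :: 'a fls) \<in> range laurent_of_poly"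
    by (rule range_eqI[of _ _ 0]) simp
  show "a + b + c = a + (b + c)" by transfer (simp add: add.assoc z)
  show "a + b = b + a" by transfer (simp add: add.commute z)
  show "0 + a = a" by transfer (simp add: z)
  show "- a + a = 0" by transfer (simp add: z)
  show "a - b = a + - b" by (rule minus_laurent_torus_def)
qed

end

text \<open>The quotient topology.\<close>

instantiation laurent_torus :: (comm_ring_1) topological_space
begin

definition open_laurent_torus :: "'a laurent_torus set \<Rightarrow> bool" where
  "open_laurent_torus U \<longleftrightarrow> open (to_torus -` U)"

instance
  by standard (auto simp: open_laurent_torus_def vimage_Int vimage_Union)

end

definition is_haar_probability :: "'a::comm_ring_1 laurent_torus measure \<Rightarrow> bool" where
  "is_haar_probability m \<longleftrightarrow>
     prob_space m \<and> sets m = sets borel \<and>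
     (\<forall>x. \<forall>A\<in>sets borel. emeasure m ((+) x ` A) = emeasure m A)"

definition haar_probability :: "'a::comm_ring_1 laurent_torus measure" where
  "haar_probability = (THE m. is_haar_probability m)"

section \<open>Existence and uniqueness of the Haar probability\<close>

lift_definition torus_coeff :: "'a::comm_ring_1 laurent_torus \<Rightarrow> nat \<Rightarrow> 'a" is
  "\<lambda>f i. fls_nth f (int i + 1)"
proof (rule ext)
  fix f g :: "'a fls" and i
  assume "f - g \<in> range laurent_of_poly"
  then obtain n where "f - g = laurent_of_poly n" by auto
  then have "fls_nth (f - g) (int i + 1) = 0"
    by (simp only: fls_nth_laurent_of_poly) simp
  then show "fls_nth f (int i + 1) = fls_nth g (int i + 1)" by simp
qed

lemma to_torus_surj: "\<exists>f. x = to_torus f"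
  by (induct x rule: laurent_torus.abs_induct) blast

lemma torus_coeff_to_torus: "torus_coeff (to_torus f) i = fls_nth f (int i + 1)"
  by (simp add: torus_coeff.abs_eq)

lemma torus_coeff_add: "torus_coeff (x + y) i = torus_coeff x i + torus_coeff y i"
  by transfer simp

lemma torus_coeff_minus: "torus_coeff (- x) i = - torus_coeff x i"
  by transfer simp

lemma torus_coeff_diff: "torus_coeff (x - y) i = torus_coeff x i - torus_coeff y i"
  unfolding minus_laurent_torus_def by (simp only: torus_coeff_add torus_coeff_minus diff_conv_add_uminus)

lemma nonpos_laurent_in_range:
  fixes f :: "'a::comm_ring_1 fls"
  assumes "\<And>i. i > 0 \<Longrightarrow> fls_nth f i = 0"
  shows "f \<in> range laurent_of_poly"
proof -
  obtain N :: nat where N: "\<And>i. i < - int N \<Longrightarrow> fls_nth f i = 0"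
  proof (rule that[of "nat (- fls_subdegree f)"])
    fix i assume "i < - int (nat (- fls_subdegree f))"
    then show "fls_nth f i = 0" by (intro fls_eq0_below_subdegree) (auto split: if_splits)
  qed
  define n where "n = Abs_poly (\<lambda>i. fls_nth f (- int i))"
  have c: "coeff n i = fls_nth f (- int i)" for i
    unfolding n_def
    by (subst Abs_poly_inverse) (auto simp: MOST_nat intro!: exI[of _ N] N)
  have "f = laurent_of_poly n"
    by (rule fls_eqI) (auto simp: fls_nth_laurent_of_poly c assms)
  then show ?thesis by simp
qed

lemma torus_eqI:
  fixes x y :: "'a::comm_ring_1 laurent_torus"
  assumes "\<And>i. torus_coeff x i = torus_coeff y i"
  shows "x = y"
proof -
  obtain f g where fg: "x = to_torus f" "y = to_torus g"
    by (metis to_torus_surj)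
  have "f - g \<in> range laurent_of_poly"
  proof (rule nonpos_laurent_in_range)
    fix i :: int assume "i > 0"
    then show "fls_nth (f - g) i = 0"
      using assms[of "nat (i - 1)"] by (simp add: fg torus_coeff_to_torus)
  qed
  then show ?thesis unfolding fg by (simp add: laurent_torus.abs_eq_iff)
qed

definition torus_of_coeffs :: "(nat \<Rightarrow> 'a::comm_ring_1) \<Rightarrow> 'a laurent_torus" where
  "torus_of_coeffs s = to_torus (fps_to_fls (fps_X * Abs_fps s))"

lemma torus_coeff_of_coeffs [simp]: "torus_coeff (torus_of_coeffs s) i = s i"
  by (simp add: torus_of_coeffs_def torus_coeff_to_torus nat_add_distrib)

definition cylinder :: "nat \<Rightarrow> (nat \<Rightarrow> 'a::comm_ring_1) \<Rightarrow> 'a laurent_torus set" where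
  "cylinder n s = {x. \<forall>i<n. torus_coeff x i = s i}"

lemma open_torus_iff:
  fixes U :: "'a::comm_ring_1 laurent_torus set"
  shows "open U \<longleftrightarrow> (\<forall>x\<in>U. \<exists>n. cylinder n (torus_coeff x) \<subseteq> U)"
proof
  assume U: "open U"
  show "\<forall>x\<in>U. \<exists>n. cylinder n (torus_coeff x) \<subseteq> U"
  proof
    fix x assume x: "x \<in> U"
    obtain f where f: "x = to_torus f" by (metis to_torus_surj)
    from U have "open (to_torus -` U)" by (simp add: open_laurent_torus_def)
    moreover have "f \<in> to_torus -` U" using x f by simp
    ultimately obtain e where e: "e > 0" "\<And>g. dist g f < e \<Longrightarrow> to_torus g \<in> U"
      by (force simp: open_fls_def)
    obtain n where n: "(1/2::real) ^ n < e" using real_arch_pow_inv[OF e(1), of "1/2"] by auto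
    have "cylinder n (torus_coeff x) \<subseteq> U"
    proof
      fix y assume "y \<in> cylinder n (torus_coeff x)"
      then have y: "torus_coeff y i = torus_coeff x i" if "i < n" for i
        using that by (simp add: cylinder_def)
      define h where "h = fps_to_fls (fps_X * Abs_fps (torus_coeff (y - x)))"
      have h: "fls_nth h i = 0" if "i < int n + 1" for i
      proof (cases "i \<le> 0")
        case False
        then have "nat i - Suc 0 < n" using that by auto
        with y[of "nat i - Suc 0"] show ?thesis
          by (auto simp: h_def torus_coeff_diff)
      qed (auto simp: h_def)
      have hs: "h \<noteq> 0 \<Longrightarrow> fls_subdegree h \<ge> int n + 1"
        using h by (metis linorder_not_le nth_fls_subdegree_nonzero)
      have "dist (f + h) f \<le> (1/2) ^ n"
      proof (cases "h = 0")
        case False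
        with hs have "fls_subdegree h \<ge> 0" "n \<le> nat (fls_subdegree h)" by auto
        then show ?thesis using False
          by (simp add: dist_fls_def power_one_over inverse_eq_divide divide_simps)
      qed auto
      with n have "to_torus (f + h) \<in> U" by (intro e(2)) simp
      moreover have "to_torus (f + h) = y"
      proof (rule torus_eqI)
        fix i
        have "fls_nth h (int i + 1) = torus_coeff y i - torus_coeff x i"
          by (simp add: h_def nat_add_distrib torus_coeff_diff)
        then show "torus_coeff (to_torus (f + h)) i = torus_coeff y i"
          by (simp add: torus_coeff_to_torus f)
      qed
      ultimately show "y \<in> U" by simp
    qed
    then show "\<exists>n. cylinder n (torus_coeff x) \<subseteq> U" ..
  qed
next
  assume U: "\<forall>x\<in>U. \<exists>n. cylinder n (torus_coeff x) \<subseteq> U"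
  show "open U"
    unfolding open_laurent_torus_def open_fls_def
  proof
    fix f assume "f \<in> to_torus -` U"
    then obtain n where n: "cylinder n (torus_coeff (to_torus f)) \<subseteq> U" using U by auto
    have "{g. dist g f < (1/2) ^ n} \<subseteq> to_torus -` U"
    proof
      fix g assume "g \<in> {g. dist g f < (1/2) ^ n}"
      then have d: "dist g f < (1/2) ^ n" by simp
      have sd: "g = f \<or> fls_subdegree (g - f) > int n"
      proof (rule ccontr)
        assume "\<not> (g = f \<or> fls_subdegree (g - f) > int n)"
        then have neq: "g \<noteq> f" and le: "fls_subdegree (g - f) \<le> int n" by auto
        have "dist g f \<ge> (1/2) ^ n"
        proof (cases "fls_subdegree (g - f) \<ge> 0")
          case True
          with neq le show ?thesis
            by (simp add: dist_fls_def power_one_over inverse_eq_divide divide_simps)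
        next
          case False
          have "(1/2::real) ^ n \<le> 1" by (simp add: power_le_one)
          also have "\<dots> \<le> 2 ^ nat (- fls_subdegree (g - f))" by simp
          finally show ?thesis using neq False by (simp add: dist_fls_def)
        qed
        with d show False by simp
      qed
      have "fls_nth (g - f) (int i + 1) = 0" if "i < n" for i
        using sd that
        by (cases "g = f") (auto intro: fls_eq0_below_subdegree simp del: fls_minus_nth)
      then have "to_torus g \<in> cylinder n (torus_coeff (to_torus f))"
        by (simp add: cylinder_def torus_coeff_to_torus)
      with n show "g \<in> to_torus -` U" by auto
    qed
    then show "\<exists>r>0. {g. dist g f < r} \<subseteq> to_torus -` U"
      by (intro exI[of _ "(1/2) ^ n"]) auto
  qed
qed

lemma open_cylinder: "open (cylinder n s)"
  unfolding open_torus_iff by (auto simp: cylinder_def intro!: exI[of _ n])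

lemma countable_cylinders:
  "countable (range (\<lambda>(n, s). cylinder n (s :: nat \<Rightarrow> 'a::{comm_ring_1,finite})))"
proof -
  have "range (\<lambda>(n, s). cylinder n (s :: nat \<Rightarrow> 'a)) \<subseteq>
      range (\<lambda>l :: 'a list. cylinder (length l) ((!) l))"
  proof clarify
    fix n and s :: "nat \<Rightarrow> 'a"
    have "cylinder n s = cylinder (length (map s [0..<n])) ((!) (map s [0..<n]))"
      by (auto simp: cylinder_def)
    then show "cylinder n s \<in> range (\<lambda>l :: 'a list. cylinder (length l) ((!) l))" by blast
  qed
  then show ?thesis by (rule countable_subset) simp
qed

abbreviation cylinders :: "'a::{comm_ring_1,finite} laurent_torus set set" where
  "cylinders \<equiv> insert {} (range (\<lambda>(n, s). cylinder n s))"

lemma borel_torus_eq: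
  "sets (borel :: 'a::{comm_ring_1,finite} laurent_torus measure) = sigma_sets UNIV cylinders"
proof
  have "sigma_sets UNIV {U :: 'a laurent_torus set. open U} \<subseteq> sigma_sets UNIV cylinders"
  proof (rule sigma_sets_mono, clarify)
    fix U :: "'a laurent_torus set" assume U: "open U"
    let ?F = "{C \<in> range (\<lambda>(n, s). cylinder n s). C \<subseteq> U}"
    have "U = \<Union>?F"
    proof
      show "U \<subseteq> \<Union>?F"
      proof
        fix x assume x: "x \<in> U"
        with U obtain n where n: "cylinder n (torus_coeff x) \<subseteq> U" by (auto simp: open_torus_iff)
        have "x \<in> cylinder n (torus_coeff x)" by (simp add: cylinder_def)
        moreover have "cylinder n (torus_coeff x) \<in> ?F" using n by auto
        ultimately show "x \<in> \<Union>?F" by (rule UnionI[rotated])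
      qed
    qed auto
    moreover have "\<Union>?F \<in> sigma_sets UNIV cylinders"
      by (rule sigma_sets_UNION)
         (use countable_cylinders in \<open>auto intro: countable_subset\<close>)
    ultimately show "U \<in> sigma_sets UNIV cylinders" by simp
  qed
  then show "sets (borel :: 'a laurent_torus measure) \<subseteq> sigma_sets UNIV cylinders"
    by (simp add: borel_def)
next
  have "cylinders \<subseteq> sets (borel :: 'a laurent_torus measure)"
    by (auto intro: borel_open open_cylinder)
  then show "sigma_sets UNIV cylinders \<subseteq> sets (borel :: 'a laurent_torus measure)"
    using sets.sigma_sets_subset[of cylinders "borel :: 'a laurent_torus measure"] by simp
qed

lemma Int_stable_cylinders: "Int_stable (cylinders :: 'a::{comm_ring_1,finite} laurent_torus set set)"
proof -
  have *: "cylinder n s \<inter> cylinder m r \<in> cylinders" if "n \<le> m"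
    for n m and s r :: "nat \<Rightarrow> 'a"
  proof (cases "\<forall>i<n. s i = r i")
    case True
    then have "cylinder n s \<inter> cylinder m r = cylinder m r" using that by (auto simp: cylinder_def)
    then show ?thesis by auto
  next
    case False
    then obtain i where "i < n" "s i \<noteq> r i" by auto
    then have "cylinder n s \<inter> cylinder m r = {}" using that by (fastforce simp: cylinder_def)
    then show ?thesis by auto
  qed
  have "cylinder n s \<inter> cylinder m r \<in> cylinders" for n m and s r :: "nat \<Rightarrow> 'a"
    using *[of n m s r] *[of m n r s] by (cases "n \<le> m") (auto simp: Int_commute)
  then show ?thesis unfolding Int_stable_def by auto
qed

lemma measure_eq_on_cylinders:
  fixes m m' :: "'a::{comm_ring_1,finite} laurent_torus measure"
  assumes "prob_space m" "sets m = sets borel" "sets m' = sets borel"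
    and "\<And>n s. emeasure m (cylinder n s) = emeasure m' (cylinder n s)"
  shows "m = m'"
proof (rule measure_eqI_generator_eq[where E = cylinders and \<Omega> = UNIV
      and A = "\<lambda>_. cylinder 0 (\<lambda>_. 0)"])
  interpret prob_space m by fact
  show "emeasure m (cylinder 0 (\<lambda>_. 0)) \<noteq> \<infinity>" by simp
qed (use assms Int_stable_cylinders in \<open>auto simp: borel_torus_eq cylinder_def\<close>)

lemma translate_eq_vimage:
  fixes x :: "'b::ab_group_add"
  shows "(+) x ` A = (\<lambda>y. - x + y) -` A"
proof
  show "(\<lambda>y. - x + y) -` A \<subseteq> (+) x ` A"
  proof
    fix y assume "y \<in> (\<lambda>y. - x + y) -` A"
    then show "y \<in> (+) x ` A" by (intro image_eqI[of _ _ "- x + y"]) auto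
  qed
qed auto

lemma translate_cylinder:
  "(+) x ` cylinder n s = cylinder n (\<lambda>i. torus_coeff x i + s i)"
  unfolding translate_eq_vimage
  by (auto simp: cylinder_def torus_coeff_diff algebra_simps)

lemma cylinder_Suc:
  "cylinder n s = (\<Union>a\<in>UNIV. cylinder (Suc n) (s(n := a)))"
  by (auto simp: cylinder_def less_Suc_eq)

lemma emeasure_haar_cylinder:
  fixes m :: "'a::{comm_ring_1,finite} laurent_torus measure"
  assumes m: "is_haar_probability m"
  shows "emeasure m (cylinder n s) = ennreal ((1 / real CARD('a)) ^ n)"
proof -
  interpret prob_space m using m by (simp add: is_haar_probability_def)
  have sets [measurable_cong]: "sets m = sets borel" using m by (simp add: is_haar_probability_def)
  have cs: "cylinder k r \<in> sets m" for k r
    by (auto simp: sets intro: borel_open open_cylinder)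
  have inv: "emeasure m (cylinder k r) = emeasure m (cylinder k s)" for k r s
  proof -
    have "(+) (torus_of_coeffs (\<lambda>i. s i - r i)) ` cylinder k r = cylinder k s"
      by (simp add: translate_cylinder)
    moreover have "cylinder k r \<in> sets borel" using cs sets by simp
    ultimately show ?thesis
      using m by (metis is_haar_probability_def)
  qed
  have sp: "space m = UNIV" using sets_eq_imp_space_eq[OF sets] by simp
  have "measure m (cylinder n s) = (1 / real CARD('a)) ^ n"
  proof (induction n)
    case 0
    have "cylinder 0 s = space m" by (auto simp: cylinder_def sp)
    then show ?case by (simp add: prob_space)
  next
    case (Suc n)
    have "measure m (cylinder n s) = (\<Sum>a\<in>UNIV. measure m (cylinder (Suc n) (s(n := a))))"
      unfolding cylinder_Suc[of n s]
      by (rule finite_measure_finite_Union)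
         (auto simp: cs disjoint_family_on_def, auto simp: cylinder_def)
    also have "\<dots> = (\<Sum>a\<in>(UNIV :: 'a set). measure m (cylinder (Suc n) s))"
      using inv[of "Suc n" "s(n := a)" s for a] by (intro sum.cong refl) (simp add: measure_def)
    finally show ?case using Suc by (simp add: field_simps)
  qed
  then show ?thesis by (simp add: emeasure_eq_measure)
qed

lemma haar_probability_unique:
  fixes m m' :: "'a::{comm_ring_1,finite} laurent_torus measure"
  assumes "is_haar_probability m" "is_haar_probability m'"
  shows "m = m'"
  using assms
  by (intro measure_eq_on_cylinders) (auto simp: emeasure_haar_cylinder is_haar_probability_def)

lemma haar_probability_exists:
  "\<exists>m :: 'a::{comm_ring_1,finite} laurent_torus measure. is_haar_probability m"
proof -
  define U where "U = (\<lambda>_ :: nat. uniform_count_measure (UNIV :: 'a set))"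
  interpret U: product_prob_space U UNIV
    by (intro product_prob_spaceI) (simp add: U_def prob_space_uniform_count_measure)
  let ?P = "Pi\<^sub>M UNIV U"
  have spU: "space (U i) = UNIV" "sets (U i) = UNIV" for i
    by (simp_all add: U_def space_uniform_count_measure sets_uniform_count_measure)
  have spP: "space ?P = UNIV" by (simp add: space_PiM spU)
  have vc: "torus_of_coeffs -` cylinder n s = {w \<in> space ?P. \<forall>i\<in>{..<n}. w i \<in> {s i}}" for n s
    by (auto simp: cylinder_def spP)
  have vm: "{w \<in> space ?P. \<forall>i\<in>{..<n}. w i \<in> {s i}} \<in> sets ?P" for n s
  proof (rule sets.sets_Collect_finite_All)
    fix i assume "i \<in> {..<n}"
    have "(\<lambda>w. w i) -` {s i} \<inter> space ?P \<in> sets ?P"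
      by (rule measurable_sets[OF measurable_component_singleton]) (simp_all add: spU)
    moreover have "(\<lambda>w. w i) -` {s i} \<inter> space ?P = {w \<in> space ?P. w i \<in> {s i}}" by blast
    ultimately show "{w \<in> space ?P. w i \<in> {s i}} \<in> sets ?P" by metis
  qed simp
  have meas: "torus_of_coeffs \<in> measurable ?P borel"
  proof (rule measurable_sigma_sets[OF borel_torus_eq])
    fix A :: "'a laurent_torus set" assume "A \<in> cylinders"
    then consider "A = {}" | n s where "A = cylinder n s" by auto
    then show "torus_of_coeffs -` A \<inter> space ?P \<in> sets ?P"
    proof cases
      case 2 then show ?thesis using vm[of n s] by (simp add: vc spP)
    qed auto
  qed (auto simp: )
  define m where "m = distr ?P borel torus_of_coeffs"
  interpret prob_space m unfolding m_def by (rule U.P.prob_space_distr[OF meas])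
  have sets: "sets m = sets borel" by (simp add: m_def)
  have cyl: "emeasure m (cylinder n s) = ennreal (1 / real CARD('a)) ^ n" for n s
  proof -
    have "emeasure m (cylinder n s) = emeasure ?P (torus_of_coeffs -` cylinder n s \<inter> space ?P)"
      unfolding m_def by (rule emeasure_distr[OF meas]) (simp add: borel_open open_cylinder)
    also have "torus_of_coeffs -` cylinder n s \<inter> space ?P =
        {w \<in> space ?P. \<forall>i\<in>{..<n}. w i \<in> {s i}}" by (simp add: vc spP)
    also have "emeasure ?P \<dots> = (\<Prod>i<n. emeasure (U i) {s i})"
      by (rule U.emeasure_PiM_Collect) (auto simp: spU)
    also have "\<dots> = ennreal (1 / real CARD('a)) ^ n"
      by (simp add: U_def emeasure_uniform_count_measure)
    finally show ?thesis .
  qed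
  have "emeasure m ((+) x ` A) = emeasure m A" if A: "A \<in> sets borel" for x A
  proof -
    have vim: "(\<lambda>y. - x + y) -` cylinder n s = cylinder n (\<lambda>i. torus_coeff x i + s i)" for n s
      by (simp only: translate_eq_vimage[symmetric] translate_cylinder)
    have spm: "space m = UNIV" by (simp add: m_def)
    have meas': "(\<lambda>y. - x + y) \<in> measurable m borel"
    proof (rule measurable_sigma_sets[OF borel_torus_eq])
      fix A :: "'a laurent_torus set" assume "A \<in> cylinders"
      then consider "A = {}" | n s where "A = cylinder n s" by auto
      then show "(\<lambda>y. - x + y) -` A \<inter> space m \<in> sets m"
      proof cases
        case 2
        show ?thesis
          unfolding 2 vim spm sets by (simp add: borel_open open_cylinder)
      qed auto
    qed (auto)
    have "m = distr m borel (\<lambda>y. - x + y)"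
    proof (rule measure_eq_on_cylinders)
      fix n s
      have "emeasure (distr m borel (\<lambda>y. - x + y)) (cylinder n s) =
          emeasure m ((\<lambda>y. - x + y) -` cylinder n s \<inter> space m)"
        by (rule emeasure_distr[OF meas']) (simp add: borel_open open_cylinder)
      also have "\<dots> = emeasure m (cylinder n s)"
        by (simp only: vim spm Int_UNIV_right cyl)
      finally show "emeasure m (cylinder n s) =
          emeasure (distr m borel (\<lambda>y. - x + y)) (cylinder n s)" ..
    qed (auto simp: sets prob_space_axioms)
    then have "emeasure m A = emeasure (distr m borel (\<lambda>y. - x + y)) A" by simp
    also have "\<dots> = emeasure m ((\<lambda>y. - x + y) -` A \<inter> space m)"
      by (rule emeasure_distr[OF meas' A])
    also have "\<dots> = emeasure m ((+) x ` A)"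
      by (simp only: translate_eq_vimage spm Int_UNIV_right)
    finally show ?thesis by simp
  qed
  then have "is_haar_probability m"
    using prob_space_axioms sets by (simp add: is_haar_probability_def)
  then show ?thesis ..
qed

theorem is_haar_probability_haar_probability:
  "is_haar_probability (haar_probability :: 'a::{comm_ring_1,finite} laurent_torus measure)"
  unfolding haar_probability_def
  by (rule theI') (metis haar_probability_exists haar_probability_unique)

section \<open>Well-distribution\<close>

definition folner_sequence :: "(nat \<Rightarrow> 'b::ab_group_add set) \<Rightarrow> bool" where
  "folner_sequence \<Phi> \<longleftrightarrow>
     (\<forall>N. finite (\<Phi> N) \<and> \<Phi> N \<noteq> {}) \<and>
     (\<forall>n. (\<lambda>N. real (card (sym_diff ((\<lambda>x. x + n) ` \<Phi> N) (\<Phi> N))) / real (card (\<Phi> N)))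
        \<longlonglongrightarrow> 0)"

definition well_distributed :: "('a::field poly \<Rightarrow> 'a fls) \<Rightarrow> bool" where
  "well_distributed a \<longleftrightarrow>
     (\<forall>\<Phi> (g :: 'a laurent_torus \<Rightarrow> complex).
        folner_sequence \<Phi> \<and> continuous_on UNIV g \<longrightarrow>
        (\<lambda>N. (\<Sum>n\<in>\<Phi> N. g (to_torus (a n))) / of_nat (card (\<Phi> N)))
          \<longlonglongrightarrow> (\<integral>x. g x \<partial>haar_probability))"

definition good_for_irrational_equidistribution :: "'a::field poly poly \<Rightarrow> bool" where
  "good_for_irrational_equidistribution Q \<longleftrightarrow>
     (\<forall>\<alpha>. \<alpha> \<notin> rational_laurent \<longrightarrow> well_distributed (\<lambda>n. laurent_of_poly (poly Q n) * \<alpha>))"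

section \<open>The finite field with $p^k$ elements\<close>

text \<open>
  For $k \ge 1$ this is the subfield of order $p^k$ of the algebraic closure of the prime field;
  for $k = 0$ the set is the whole closure.
\<close>

definition galois_field :: "nat \<Rightarrow> 'p::prime_card mod_ring alg_closure set" where
  "galois_field k = {x. x ^ (CARD('p) ^ k) = x}"

lemma card_galois_field:
  assumes "k > 0"
  shows "card (galois_field k :: 'p::prime_card mod_ring alg_closure set) = CARD('p) ^ k"
proof -
  let ?q = "CARD('p) ^ k"
  let ?f = "monom 1 ?q - [:0, 1:] :: 'p mod_ring alg_closure poly"
  have q1: "?q > 1" by (rule one_less_power[OF prime_gt_1_nat[OF prime_card] assms])
  have "(of_nat CARD('p) :: 'p mod_ring alg_closure) = 0"
    using of_nat_CHAR[where 'a="'p mod_ring alg_closure"] by simp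
  then have q0: "(of_nat ?q :: 'p mod_ring alg_closure) = 0" using assms by (simp add: power_0_left)
  have pd: "poly (pderiv ?f) x = - 1" for x
    by (simp add: pderiv_diff pderiv_monom q0 pderiv_pCons del: of_nat_power)
  have deg: "degree ?f = ?q"
  proof -
    have "degree ?f = degree (monom 1 ?q + (- [:0, 1:]) :: 'p mod_ring alg_closure poly)"
      by (simp only: diff_conv_add_uminus)
    also have "\<dots> = degree (monom 1 ?q :: 'p mod_ring alg_closure poly)"
      by (rule degree_add_eq_left) (use q1 in \<open>simp add: degree_monom_eq\<close>)
    finally show ?thesis by (simp add: degree_monom_eq)
  qed
  with q1 have f0: "?f \<noteq> 0" by (metis degree_0 not_less_zero)
  obtain A where A: "size A = ?q" "?f = smult (lead_coeff ?f) (\<Prod>x\<in>#A. [:-x, 1:])"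
    using alg_closed_imp_factorization[OF f0] deg by auto
  have "count A x \<le> 1" for x
  proof (rule ccontr)
    assume "\<not> count A x \<le> 1"
    then have "{#x, x#} \<subseteq># A" by (auto simp: subseteq_mset_def)
    then obtain B where "A = {#x, x#} + B" by (auto simp: subset_mset.le_iff_add)
    then have "?f = [:-x, 1:] * ([:-x, 1:] * smult (lead_coeff ?f) (\<Prod>x\<in>#B. [:-x, 1:]))"
      using A(2) by simp
    then obtain g where g: "?f = [:-x, 1:] * ([:-x, 1:] * g)" by blast
    have "poly (pderiv ?f) x = 0"
      unfolding g by (simp add: pderiv_mult del: mult_pCons_left)
    with pd show False by simp
  qed
  then have "count A x = (if x \<in># A then 1 else 0)" for x
    by (metis count_eq_zero_iff le_antisym count_greater_eq_one_iff)
  then have "size A = card (set_mset A)"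
    by (simp add: size_multiset_overloaded_eq)
  moreover have "galois_field k = set_mset A"
  proof -
    have "x \<in> galois_field k \<longleftrightarrow> poly ?f x = 0" for x
      by (simp add: galois_field_def poly_monom)
    moreover have "poly ?f x = 0 \<longleftrightarrow> x \<in># A" for x
    proof -
      have "lead_coeff ?f \<noteq> 0" using f0 by (simp only: leading_coeff_0_iff not_False_eq_True)
      then have "poly (smult (lead_coeff ?f) (\<Prod>x\<in>#A. [:-x, 1:])) x = 0 \<longleftrightarrow> x \<in># A"
        unfolding poly_smult by (simp only: mult_eq_0_iff simp_thms) (auto simp: poly_prod_mset)
      with A(2) show ?thesis by metis
    qed
    ultimately show ?thesis by auto
  qed
  ultimately show ?thesis using A(1) by simp
qed

lemma subfield_galois_field:
  fixes x y :: "'p::prime_card mod_ring alg_closure" and c :: "'p mod_ring"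
  assumes "x \<in> galois_field k" "y \<in> galois_field k"
  shows "x + y \<in> galois_field k" "x * y \<in> galois_field k" "- x \<in> galois_field k"
    "inverse x \<in> galois_field k" "to_ac c \<in> galois_field k"
proof -
  have c: "to_ac c \<in> galois_field k" for c :: "'p mod_ring"
  proof -
    have "to_ac (c ^ (CARD('p) ^ k)) = to_ac c"
      using finite_field_power_card_power_eq_same[of "CARD('p) ^ k" k c] by simp
    then show ?thesis by (simp add: galois_field_def)
  qed
  then show "to_ac c \<in> galois_field k" .
  have *: "x * y \<in> galois_field k" if "x \<in> galois_field k" "y \<in> galois_field k"
    for x y :: "'p mod_ring alg_closure"
    using that by (simp add: galois_field_def power_mult_distrib)
  show "x * y \<in> galois_field k" using assms by (rule *)
  show "inverse x \<in> galois_field k" using assms by (simp add: galois_field_def power_inverse)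
  have "(x + y) ^ (CARD('p) ^ k) = x ^ (CARD('p) ^ k) + y ^ (CARD('p) ^ k)"
    by (rule freshmans_dream') (use prime_card[where 'a='p] in auto)
  then show "x + y \<in> galois_field k" using assms by (simp add: galois_field_def)
  show "- x \<in> galois_field k" using *[OF c[of "-1"] assms(1)] by simp
qed

end

theory Submission
  imports Defs
begin

text \<open>
  Let $\psi_b$ run through the additive characters of $\mathbb{F}_q$, $q = p^k$. Modulo the trace every
  $bQ(z)$ reduces to a polynomial with exponents prime to $p$. If for some $b \ne 0$ this
  reduction were constant, the conjugates of $b$ would be the coefficients of an irrational
  lacunary series $\alpha$ for which $Q(n)\alpha$ misses $t^{-1}$ for all $n$, contradicting goodness.
  Hence Weyl differencing gives $\sum_z \psi_b(Q(z)) = o(q)$ uniformly in $b \ne 0$ as $k \to \infty$.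

  For a color $C$ let $N_C(v)$ be $1/q$ times the number of pairs $(x,y) \in C^2$ with $P(x)-P(y)=v$. A
  product of functions $N_C$ is positive definite with bounded total spectral mass and mean at
  least the product of the squared densities, so its average along $Q(z)$ is bounded below. Thus
  all dense colors have many common return times $Q(z)$, and if the other colors are sparse enough,
  many of these $z$ lie in a dense color.
\<close>

section \<open>Finite fields and their additive characters\<close>

text \<open>Characteristic p is the first obstacle: differencing turns \<open>x^(p^j)\<close> into a
  constant and loses the expected leading term when p divides the degree. So the reduction modulo
  the trace is repeated after every differencing, and uniformity in b and k rests on bounding the
  number of shifts with vanishing reduction by the degree alone. The second is to pass from finite
  fields to the infinite ring of polynomials in t. Raising a polynomial n to the power
  \<open>p^j\<close> moves its coefficient at \<open>t^(p^i)\<close> to \<open>t^(p^(i+j))\<close>.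
  Against a series supported on the \<open>t^(-p^j-1)\<close> this shifts the coefficient sequence,
  just as inverse Frobenius shifts the conjugates of b, so a linear relation among conjugates
  becomes a recurrence along the series. The third is that the return times Q(z) of one dense color
  may occur only at z of other colors. Hence products over families of colors; nonnegative Fourier
  coefficients reduce their lower bound to the frequency 0. Relative to the main term the losses are
  1/3 (character sums), 1/3 (sparse colors) and 1/4 (the negated conclusion), together less than
  1.\<close>

lemma CARD_prime_gt_1: "1 < CARD('p::prime_card)"
  by (rule prime_gt_1_nat[OF prime_card])

lemma CARD_prime_pos: "0 < CARD('p::prime_card)"
  by (rule prime_gt_0_nat[OF prime_card])

lemma finite_galois_field:
  assumes "k > 0"
  shows "finite (galois_field k :: 'p::prime_card mod_ring alg_closure set)"
  using card_galois_field[OF assms, where 'p='p]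
  by (intro card_ge_0_finite) (simp add: CARD_prime_pos)

lemma galois_field_zero: "0 \<in> galois_field k"
  and galois_field_one: "1 \<in> galois_field k"
  by (simp_all add: galois_field_def CARD_prime_pos)

lemmas galois_field_add = subfield_galois_field(1)
  and galois_field_mult = subfield_galois_field(2)
  and galois_field_to_ac = subfield_galois_field(5)[OF galois_field_zero galois_field_zero]

lemma galois_field_minus: "x \<in> galois_field k \<Longrightarrow> - x \<in> galois_field k"
  and galois_field_inverse: "x \<in> galois_field k \<Longrightarrow> inverse x \<in> galois_field k"
  using subfield_galois_field(3,4) by blast+

lemma galois_field_diff:
  "x \<in> galois_field k \<Longrightarrow> y \<in> galois_field k \<Longrightarrow> x - y \<in> galois_field k"
  using galois_field_add[of x k "- y"] galois_field_minus[of y k] by simp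

lemma galois_field_power: "x \<in> galois_field k \<Longrightarrow> x ^ n \<in> galois_field k"
  by (induction n) (auto simp: galois_field_one galois_field_mult)

lemma galois_field_sum:
  "(\<And>i. i \<in> A \<Longrightarrow> f i \<in> galois_field k) \<Longrightarrow> (\<Sum>i\<in>A. f i) \<in> galois_field k"
  by (induction A rule: infinite_finite_induct) (auto simp: galois_field_zero galois_field_add)

lemma galois_field_of_nat: "of_nat n \<in> galois_field k"
  by (induction n) (auto simp: galois_field_zero galois_field_one galois_field_add)

lemmas galois_field_intros = galois_field_zero galois_field_one galois_field_add
  galois_field_mult galois_field_minus galois_field_inverse galois_field_diff
  galois_field_power galois_field_sum galois_field_of_nat galois_field_to_ac

section \<open>Frobenius and its inverse\<close>

lemma frobenius_add:
  fixes x y :: "'p::prime_card mod_ring alg_closure"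
  shows "(x + y) ^ (CARD('p) ^ j) = x ^ (CARD('p) ^ j) + y ^ (CARD('p) ^ j)"
  by (rule freshmans_dream') (use prime_card[where 'a='p] in auto)

lemma frobenius_sum:
  fixes f :: "'i \<Rightarrow> 'p::prime_card mod_ring alg_closure"
  shows "(\<Sum>i\<in>A. f i) ^ (CARD('p) ^ j) = (\<Sum>i\<in>A. f i ^ (CARD('p) ^ j))"
  by (induction A rule: infinite_finite_induct)
     (auto simp: frobenius_add CARD_prime_pos)

lemma frobenius_to_ac:
  fixes c :: "'p::prime_card mod_ring"
  shows "to_ac c ^ (CARD('p) ^ j) = to_ac c"
  using galois_field_to_ac[of c j] by (simp add: galois_field_def)

lemma galois_field_frobenius_period:
  fixes x :: "'p::prime_card mod_ring alg_closure"
  assumes "x \<in> galois_field k"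
  shows "x ^ (CARD('p) ^ (k * j)) = x"
proof (induction j)
  case (Suc j)
  have "x ^ (CARD('p) ^ (k * Suc j)) = (x ^ (CARD('p) ^ k)) ^ (CARD('p) ^ (k * j))"
    by (simp add: power_add power_mult)
  with assms Suc show ?case by (simp add: galois_field_def)
qed simp

text \<open>For k > 0 this inverts the j-fold Frobenius on the field with \<open>p^k\<close>
  elements, since k - 1 further Frobenius steps undo one. Being a power, it is additive on the whole
  closure, and j may exceed k.\<close>

definition frob_root :: "nat \<Rightarrow> nat \<Rightarrow> 'p::prime_card mod_ring alg_closure \<Rightarrow> 'p mod_ring alg_closure"
  where "frob_root k j x = x ^ (CARD('p) ^ ((k - 1) * j))"

lemma frob_root_pow:
  fixes x :: "'p::prime_card mod_ring alg_closure"
  assumes "k > 0" "x \<in> galois_field k"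
  shows "frob_root k j x ^ (CARD('p) ^ j) = x"
proof -
  have "(k - 1) * j + j = k * j" using assms(1) by (cases k) auto
  then have "frob_root k j x ^ (CARD('p) ^ j) = x ^ (CARD('p) ^ (k * j))"
    by (simp add: frob_root_def flip: power_mult power_add)
  then show ?thesis using galois_field_frobenius_period[OF assms(2)] by simp
qed

lemma frob_root_mem: "x \<in> galois_field k \<Longrightarrow> frob_root k j x \<in> galois_field k"
  by (simp add: frob_root_def galois_field_power)

lemma frob_root_zero [simp]: "frob_root k j 0 = 0"
  by (simp add: frob_root_def CARD_prime_pos)

lemma frob_root_sum: "frob_root k j (\<Sum>i\<in>A. f i) = (\<Sum>i\<in>A. frob_root k j (f i))"
  by (simp add: frob_root_def frobenius_sum)

lemma frob_root_to_ac_mult: "frob_root k j (to_ac c * x) = to_ac c * frob_root k j x"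
  by (simp add: frob_root_def power_mult_distrib frobenius_to_ac)

lemma frob_root_add:
  fixes x :: "'p::prime_card mod_ring alg_closure"
  shows "frob_root k i (frob_root k j x) = frob_root k (i + j) x"
proof -
  have "(k - 1) * j + (k - 1) * i = (k - 1) * (i + j)" by (simp add: add_mult_distrib2)
  then show ?thesis by (simp only: frob_root_def power_mult[symmetric] power_add[symmetric])
qed

lemma frob_root_period:
  assumes "x \<in> galois_field k"
  shows "frob_root k (k * j) x = x"
  using galois_field_frobenius_period[OF assms, of "(k - 1) * j"]
  by (simp add: frob_root_def mult.left_commute)

section \<open>The trace to the prime field\<close>

definition field_trace :: "nat \<Rightarrow> 'p::prime_card mod_ring alg_closure \<Rightarrow> 'p mod_ring" where
  "field_trace k x = of_ac (\<Sum>i<k. x ^ (CARD('p) ^ i))"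

lemma galois_field_prime: "galois_field 1 = range (to_ac :: 'p::prime_card mod_ring \<Rightarrow> _)"
proof -
  have "card (range (to_ac :: 'p mod_ring \<Rightarrow> _)) = CARD('p)"
    by (subst card_image) (auto simp: inj_to_ac)
  then show ?thesis
    using card_galois_field[of 1, where 'p='p] finite_galois_field[of 1, where 'p='p]
    by (intro card_subset_eq[symmetric]) (auto simp: galois_field_to_ac)
qed

text \<open>Frobenius permutes the conjugates cyclically: the shifted sum loses x and gains
  \<open>x^(p^k) = x\<close>.\<close>

lemma sum_conjugates_frobenius:
  fixes x :: "'p::prime_card mod_ring alg_closure"
  assumes "x \<in> galois_field k"
  shows "(\<Sum>i<k. (x ^ CARD('p)) ^ (CARD('p) ^ i)) = (\<Sum>i<k. x ^ (CARD('p) ^ i))"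
proof -
  have "(\<Sum>i<k. (x ^ CARD('p)) ^ (CARD('p) ^ i)) + x = (\<Sum>i<Suc k. x ^ (CARD('p) ^ i))"
    by (simp only: sum.lessThan_Suc_shift) (simp flip: power_mult power_Suc)
  also have "\<dots> = (\<Sum>i<k. x ^ (CARD('p) ^ i)) + x"
    using assms by (simp add: galois_field_def)
  finally show ?thesis by simp
qed

text \<open>The sum of conjugates is fixed by Frobenius, hence lies in the prime field, where
  \<open>of_ac\<close> really inverts \<open>to_ac\<close>.\<close>

lemma to_ac_field_trace:
  fixes x :: "'p::prime_card mod_ring alg_closure"
  assumes "x \<in> galois_field k"
  shows "to_ac (field_trace k x) = (\<Sum>i<k. x ^ (CARD('p) ^ i))"
proof -
  let ?s = "\<Sum>i<k. x ^ (CARD('p) ^ i)"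
  have "?s ^ (CARD('p) ^ 1) = (\<Sum>i<k. (x ^ CARD('p)) ^ (CARD('p) ^ i))"
    unfolding frobenius_sum by (simp flip: power_mult add: mult.commute)
  then have "?s \<in> galois_field 1"
    using sum_conjugates_frobenius[OF assms] by (simp add: galois_field_def)
  then show ?thesis unfolding galois_field_prime field_trace_def by (rule to_ac_of_ac)
qed

lemma field_trace_eqI:
  assumes "x \<in> galois_field k" "to_ac c = (\<Sum>i<k. x ^ (CARD('p) ^ i))"
  shows "field_trace k (x :: 'p::prime_card mod_ring alg_closure) = c"
  using assms to_ac_field_trace by (metis to_ac_eq_iff)

lemma field_trace_add:
  assumes "x \<in> galois_field k" "y \<in> galois_field k"
  shows "field_trace k (x + y) = field_trace k x + field_trace k y"
  using assms
  by (intro field_trace_eqI) (auto simp: galois_field_add to_ac_field_trace frobenius_add sum.distrib)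

lemma field_trace_zero [simp]: "field_trace k 0 = 0"
  by (simp add: field_trace_def CARD_prime_pos power_0_left)

lemma field_trace_sum:
  assumes "\<And>i. i \<in> A \<Longrightarrow> f i \<in> galois_field k"
  shows "field_trace k (\<Sum>i\<in>A. f i) = (\<Sum>i\<in>A. field_trace k (f i))"
  using assms
  by (induction A rule: infinite_finite_induct) (auto simp: field_trace_add galois_field_sum)

lemma field_trace_scale:
  assumes "x \<in> galois_field k"
  shows "field_trace k (to_ac c * x) = c * field_trace k x"
  using assms
  by (intro field_trace_eqI)
     (auto simp: galois_field_intros to_ac_field_trace power_mult_distrib frobenius_to_ac sum_distrib_left)

lemma field_trace_frobenius:
  fixes x :: "'p::prime_card mod_ring alg_closure"
  assumes "x \<in> galois_field k"
  shows "field_trace k (x ^ (CARD('p) ^ j)) = field_trace k x"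
proof (induction j)
  case (Suc j)
  have y: "x ^ (CARD('p) ^ j) \<in> galois_field k" using assms by (rule galois_field_power)
  have "x ^ (CARD('p) ^ Suc j) = (x ^ (CARD('p) ^ j)) ^ CARD('p)"
    by (simp add: mult.commute flip: power_mult)
  then have "field_trace k (x ^ (CARD('p) ^ Suc j)) = field_trace k (x ^ (CARD('p) ^ j))"
    using sum_conjugates_frobenius[OF y] by (simp add: field_trace_def)
  with Suc show ?case by simp
qed simp

text \<open>Invariance of the trace under Frobenius moves a \<open>p^j\<close>-th power from the
  variable to the coefficient, where it becomes an inverse Frobenius.\<close>

lemma field_trace_frob_root:
  fixes a y :: "'p::prime_card mod_ring alg_closure"
  assumes "k > 0" "a \<in> galois_field k" "y \<in> galois_field k"
  shows "field_trace k (frob_root k j a * y) = field_trace k (a * y ^ (CARD('p) ^ j))"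
proof -
  have "field_trace k (frob_root k j a * y) = field_trace k ((frob_root k j a * y) ^ (CARD('p) ^ j))"
    using assms by (intro field_trace_frobenius[symmetric]) (auto intro: galois_field_mult frob_root_mem)
  then show ?thesis using assms by (simp add: power_mult_distrib frob_root_pow)
qed

text \<open>The trace is given by a polynomial of degree at most \<open>p^(k-1)\<close> whose linear
  coefficient is 1; it has too few roots to vanish on \<open>p^k\<close> elements.\<close>

lemma field_trace_nonzero:
  assumes "k > 0"
  shows "\<exists>x \<in> galois_field k. field_trace k (x :: 'p::prime_card mod_ring alg_closure) \<noteq> 0"
proof (rule ccontr)
  assume "\<not> ?thesis"
  then have tr: "field_trace k x = 0" if "x \<in> galois_field k" for x :: "'p mod_ring alg_closure"
    using that by blast
  define f where "f = (\<Sum>i<k. monom (1 :: 'p mod_ring alg_closure) (CARD('p) ^ i))"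
  have p1: "CARD('p) > 1" using prime_gt_1_nat[OF prime_card] .
  have "coeff f 1 = (\<Sum>i<k. if i = 0 then 1 else 0)"
    unfolding f_def coeff_sum using p1 by (intro sum.cong) auto
  then have f0: "f \<noteq> 0" using assms by auto
  have "poly f x = (\<Sum>i<k. x ^ (CARD('p) ^ i))" for x
    by (simp add: f_def poly_sum poly_monom)
  then have "poly f x = 0" if "x \<in> galois_field k" for x
    using to_ac_field_trace[OF that] tr[OF that] by simp
  then have "card (galois_field k :: 'p mod_ring alg_closure set) \<le> card {x. poly f x = 0}"
    by (intro card_mono poly_roots_finite f0) auto
  also have "\<dots> \<le> degree f" by (rule card_poly_roots_bound[OF f0])
  also have "\<dots> \<le> CARD('p) ^ (k - 1)"
    unfolding f_def using p1
    by (intro degree_sum_le) (auto intro!: order.trans[OF degree_monom_le] power_increasing)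
  also have "\<dots> < CARD('p) ^ k" using p1 assms by (intro power_strict_increasing) auto
  finally show False by (simp add: card_galois_field[OF assms])
qed

section \<open>Additive characters and their orthogonality\<close>

definition residue_char :: "'p::prime_card mod_ring \<Rightarrow> complex" where
  "residue_char c = cis (2 * pi * real_of_int (to_int_mod_ring c) / real CARD('p))"

lemma cis_int_mod:
  assumes "n > 0"
  shows "cis (2 * pi * real_of_int (a mod int n) / real n) = cis (2 * pi * real_of_int a / real n)"
proof -
  have "real_of_int a = real_of_int (int n * (a div int n) + a mod int n)"
    by (simp only: mult_div_mod_eq)
  then have "real_of_int a = real n * real_of_int (a div int n) + real_of_int (a mod int n)"
    by (simp only: of_int_add of_int_mult of_int_of_nat_eq)
  then have "2 * pi * real_of_int a / real n =
      2 * pi * real_of_int (a div int n) + 2 * pi * real_of_int (a mod int n) / real n"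
    using assms by (simp only: ring_distribs add_divide_distrib) simp
  then show ?thesis by (simp add: cis_mult[symmetric])
qed

lemma residue_char_add: "residue_char (a + b) = residue_char a * residue_char b"
  by (simp add: residue_char_def to_int_mod_ring_add cis_int_mod cis_mult
      CARD_prime_pos add_divide_distrib ring_distribs)

lemma residue_char_zero [simp]: "residue_char 0 = 1"
  by (simp add: residue_char_def)

lemma norm_residue_char [simp]: "norm (residue_char c) = 1"
  by (simp add: residue_char_def)

lemma residue_char_eq_1_iff: "residue_char c = 1 \<longleftrightarrow> c = 0"
proof
  assume "residue_char c = 1"
  then have "cos (2 * pi * real_of_int (to_int_mod_ring c) / real CARD('a)) = 1"
    unfolding residue_char_def by (metis cis.sel(1) one_complex.sel(1))
  then obtain n :: int where "2 * pi * real_of_int (to_int_mod_ring c) / real CARD('a) = of_int n * 2 * pi"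
    by (auto simp: cos_one_2pi_int)
  then have "real_of_int (to_int_mod_ring c) = real_of_int (n * int CARD('a))"
    using CARD_prime_pos[where 'p='a] by (simp add: field_simps)
  then have n: "to_int_mod_ring c = n * int CARD('a)" by linarith
  have "to_int_mod_ring c \<in> {0..<int CARD('a)}"
    using range_to_int_mod_ring[where 'a='a] by blast
  with n have "n = 0" 
    by (metis atLeastLessThan_iff mod_mult_self2_is_0 mod_pos_pos_trivial mult_eq_0_iff less_irrefl linorder_not_le)
  with n show "c = 0" by simp
qed simp

definition field_char :: "nat \<Rightarrow> 'p::prime_card mod_ring alg_closure \<Rightarrow> complex" where
  "field_char k x = residue_char (field_trace k x)"

lemma field_char_add:
  "x \<in> galois_field k \<Longrightarrow> y \<in> galois_field k \<Longrightarrow> field_char k (x + y) = field_char k x * field_char k y"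
  by (simp add: field_char_def field_trace_add residue_char_add)

lemma field_char_zero [simp]: "field_char k 0 = 1"
  and norm_field_char [simp]: "norm (field_char k x) = 1"
  by (simp_all add: field_char_def)

lemma field_char_minus:
  assumes "x \<in> galois_field k"
  shows "field_char k (- x) = cnj (field_char k x)"
proof -
  have "field_char k (- x) * field_char k x = 1"
    using field_char_add[of "- x" k x] assms by (simp add: galois_field_minus)
  moreover have "cnj (field_char k x) * field_char k x = 1"
    by (simp add: mult.commute complex_norm_square[symmetric])
  ultimately show ?thesis by (metis mult_right_cancel mult_zero_right zero_neq_one)
qed

lemma field_char_diff:
  "x \<in> galois_field k \<Longrightarrow> y \<in> galois_field k \<Longrightarrow>
    field_char k (x - y) = field_char k x * cnj (field_char k y)"
  using field_char_add[of x k "- y"] by (simp add: galois_field_minus field_char_minus)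

lemma field_char_sum:
  fixes b :: "'p::prime_card mod_ring alg_closure"
  assumes "k > 0" "b \<in> galois_field k"
  shows "(\<Sum>x\<in>galois_field k. field_char k (b * x)) =
    (if b = 0 then of_nat (CARD('p) ^ k) else 0)"
proof (cases "b = 0")
  case False
  let ?F = "galois_field k :: 'p mod_ring alg_closure set"
  obtain w :: "'p mod_ring alg_closure" where w: "w \<in> ?F" "field_trace k w \<noteq> 0"
    using field_trace_nonzero[OF assms(1)] by blast
  \<comment> \<open>Translation by \<open>u\<close> multiplies the sum by
    \<open>field_char k w\<close>, which is not 1, so the sum is 0.\<close>
  define u where "u = w / b"
  have u: "u \<in> ?F" "b * u = w"
    using w assms False by (auto simp: u_def divide_inverse galois_field_intros)
  have "(\<Sum>x\<in>?F. field_char k (b * x)) = (\<Sum>x\<in>?F. field_char k (b * (x + u)))"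
    by (rule sum.reindex_bij_witness[of _ "\<lambda>x. x + u" "\<lambda>x. x - u"])
       (auto intro: galois_field_intros u)
  also have "\<dots> = field_char k w * (\<Sum>x\<in>?F. field_char k (b * x))"
    using u w assms by (simp add: ring_distribs field_char_add galois_field_mult sum_distrib_left mult.commute)
  finally have "(1 - field_char k w) * (\<Sum>x\<in>?F. field_char k (b * x)) = 0" by (simp add: algebra_simps)
  moreover have "field_char k w \<noteq> 1" using w by (simp add: field_char_def residue_char_eq_1_iff)
  ultimately show ?thesis using False by simp
qed (simp add: card_galois_field[OF assms(1)])

section \<open>Reduced coefficients\<close>

text \<open>Each m >= 1 is \<open>r * p^j\<close> for exactly one r prime to p and one j. Terms with
  \<open>r * p^j > D\<close> are zero and pad the inner sums to one common range;
  \<open>j <= D\<close> suffices because \<open>j < p^j\<close>.\<close>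

lemma sum_split_prime_powers:
  fixes f :: "nat \<Rightarrow> 'b::comm_monoid_add" and p :: nat
  assumes p: "prime p" and f: "\<And>m. m > D \<Longrightarrow> f m = 0"
  shows "(\<Sum>m=1..D. f m) = (\<Sum>r | r \<in> {1..D} \<and> \<not> p dvd r. \<Sum>j\<le>D. f (r * p ^ j))"
proof -
  let ?R = "{r. r \<in> {1..D} \<and> \<not> p dvd r}"
  have p1: "p > 1" using prime_gt_1_nat[OF p] .
  let ?T = "{(r, j). r \<in> ?R \<and> j \<le> D \<and> r * p ^ j \<le> D}"
  have mult: "multiplicity p (r * p ^ j) = j" if "r \<ge> 1" "\<not> p dvd r" for r j
    using that p p1 by (subst prime_elem_multiplicity_mult_distrib)
      (auto simp: not_dvd_imp_multiplicity_0 multiplicity_same_power prime_imp_prime_elem)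
  have le: "multiplicity p m \<le> m" if "m \<ge> 1" for m
  proof -
    have "multiplicity p m < p ^ multiplicity p m" by (rule power_gt_expt) (use p1 in auto)
    also have "\<dots> \<le> m" using that by (intro dvd_imp_le multiplicity_dvd) auto
    finally show ?thesis by simp
  qed
  have "(\<Sum>m=1..D. f m) = (\<Sum>(r, j)\<in>?T. f (r * p ^ j))"
  proof (rule sum.reindex_bij_witness[of _ "\<lambda>(r, j). r * p ^ j"
        "\<lambda>m. (m div p ^ multiplicity p m, multiplicity p m)"])
    fix m assume m: "m \<in> {1..D}"
    let ?j = "multiplicity p m"
    have eq: "m div p ^ ?j * p ^ ?j = m" by (simp add: multiplicity_dvd)
    then show "(case (m div p ^ ?j, ?j) of (r, j) \<Rightarrow> r * p ^ j) = m" by simp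
    have "\<not> p dvd m div p ^ ?j"
      using m p1 by (intro multiplicity_decompose) auto
    moreover have "m div p ^ ?j \<ge> 1" using eq m by (cases "m div p ^ ?j") auto
    moreover have "m div p ^ ?j \<le> D" using m by (auto intro: order.trans[OF div_le_dividend])
    moreover have "?j \<le> D" using le[of m] m by auto
    ultimately show "(m div p ^ ?j, ?j) \<in> ?T" using eq m by simp
    show "(case (m div p ^ ?j, ?j) of (r, j) \<Rightarrow> f (r * p ^ j)) = f m" using eq by simp
  qed (use mult p1 in auto)
  also have "\<dots> = (\<Sum>(r, j)\<in>?R \<times> {..D}. f (r * p ^ j))"
    by (intro sum.mono_neutral_left) (auto intro!: f simp: not_le)
  also have "\<dots> = (\<Sum>r\<in>?R. \<Sum>j\<le>D. f (r * p ^ j))"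
    by (simp add: sum.cartesian_product)
  finally show ?thesis .
qed

text \<open>Under the trace, $\beta x^{rp^j}$ agrees with $\beta^{1/p^j} x^r$; collecting these terms leaves
  only exponents prime to $p$.\<close>

definition reduced_coeff ::
  "nat \<Rightarrow> nat \<Rightarrow> (nat \<Rightarrow> 'p::prime_card mod_ring alg_closure) \<Rightarrow> nat \<Rightarrow> 'p mod_ring alg_closure" where
  "reduced_coeff k D d r =
    (if CARD('p) dvd r then 0 else \<Sum>j\<le>D. frob_root k j (d (r * CARD('p) ^ j)))"

lemma reduced_coeff_mem:
  "(\<And>m. d m \<in> galois_field k) \<Longrightarrow> reduced_coeff k D d r \<in> galois_field k"
  by (auto simp: reduced_coeff_def intro!: galois_field_sum frob_root_mem galois_field_zero)

text \<open>The sums start at exponent 1: 0 is not of the form \<open>r * p^j\<close> with r prime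
  to p, and a constant term only contributes a factor of modulus 1.\<close>

lemma field_char_reduce:
  fixes d :: "nat \<Rightarrow> 'p::prime_card mod_ring alg_closure"
  assumes k: "k > 0" and d: "\<And>m. d m \<in> galois_field k" and D: "\<And>m. m > D \<Longrightarrow> d m = 0"
    and z: "z \<in> galois_field k"
  shows "field_char k (\<Sum>m=1..D. d m * z ^ m) = field_char k (\<Sum>r=1..D. reduced_coeff k D d r * z ^ r)"
proof -
  let ?p = "CARD('p)"
  let ?R = "{r. r \<in> {1..D} \<and> \<not> ?p dvd r}"
  note mem = galois_field_intros frob_root_mem d z reduced_coeff_mem
  have "field_trace k (\<Sum>m=1..D. d m * z ^ m) = (\<Sum>m=1..D. field_trace k (d m * z ^ m))"
    by (intro field_trace_sum mem)
  also have "\<dots> = (\<Sum>r\<in>?R. \<Sum>j\<le>D. field_trace k (d (r * ?p ^ j) * z ^ (r * ?p ^ j)))"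
    by (rule sum_split_prime_powers[OF prime_card]) (simp add: D)
  also have "\<dots> = (\<Sum>r\<in>?R. field_trace k (reduced_coeff k D d r * z ^ r))"
  proof (intro sum.cong refl)
    fix r assume r: "r \<in> ?R"
    have "field_trace k (d (r * ?p ^ j) * z ^ (r * ?p ^ j)) =
        field_trace k (frob_root k j (d (r * ?p ^ j)) * z ^ r)" for j
      unfolding power_mult by (intro field_trace_frob_root[symmetric] k mem)
    then show "(\<Sum>j\<le>D. field_trace k (d (r * ?p ^ j) * z ^ (r * ?p ^ j))) =
        field_trace k (reduced_coeff k D d r * z ^ r)"
      using r by (simp add: reduced_coeff_def sum_distrib_right mem field_trace_sum)
  qed
  also have "\<dots> = (\<Sum>r=1..D. field_trace k (reduced_coeff k D d r * z ^ r))"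
    by (intro sum.mono_neutral_left) (auto simp: reduced_coeff_def)
  also have "\<dots> = field_trace k (\<Sum>r=1..D. reduced_coeff k D d r * z ^ r)"
    by (intro field_trace_sum[symmetric] mem)
  finally show ?thesis by (simp add: field_char_def)
qed

section \<open>Goodness forces nonzero reduced coefficients\<close>

text \<open>At most one j contributes, and \<open>j <= m\<close> excludes none because
  \<open>j < p^j\<close>.\<close>

definition lacunary :: "(nat \<Rightarrow> 'p::prime_card mod_ring) \<Rightarrow> nat \<Rightarrow> 'p mod_ring" where
  "lacunary h m = (\<Sum>j\<le>m. if m = CARD('p) ^ j then h j else 0)"

text \<open>The series with coefficient \<open>h j\<close> at \<open>t^(-p^j-1)\<close>. The extra
  \<open>fps_X\<close> makes the coefficient of \<open>t^(p^j)\<close> in a polynomial n meet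
  \<open>h j\<close> at \<open>t^(-1)\<close> in the product.\<close>

definition lacunary_series :: "(nat \<Rightarrow> 'p::prime_card mod_ring) \<Rightarrow> 'p mod_ring fls" where
  "lacunary_series h = fps_to_fls (fps_X * Abs_fps (lacunary h))"

lemma lacunary_power: "lacunary h (CARD('p) ^ i) = h i" for h :: "nat \<Rightarrow> 'p::prime_card mod_ring"
proof -
  have "i \<le> CARD('p) ^ i" by (rule less_imp_le[OF power_gt_expt]) (use CARD_prime_gt_1 in auto)
  then show ?thesis
    unfolding lacunary_def using CARD_prime_gt_1[where 'p='p]
    by (subst sum.cong[OF refl, of _ _ "\<lambda>j. if i = j then h j else 0"]) auto
qed

lemma lacunary_eq_0:
  fixes h :: "nat \<Rightarrow> 'p::prime_card mod_ring"
  shows "(\<And>j. m \<noteq> CARD('p) ^ j) \<Longrightarrow> lacunary h m = 0"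
  by (simp add: lacunary_def)

lemma fls_nth_lacunary_series: "fls_nth (lacunary_series h) (int m + 1) = lacunary h m"
  by (simp add: lacunary_series_def nat_add_distrib)

lemma fls_nth_laurent_of_poly_mult:
  fixes n :: "'a::comm_ring_1 poly"
  assumes "degree n \<le> N"
  shows "fls_nth (laurent_of_poly n * f) i = (\<Sum>m\<le>N. coeff n m * fls_nth f (i + int m))"
proof -
  have "laurent_of_poly n = (\<Sum>m\<le>degree n. fls_const (coeff n m) * fls_X_inv ^ m)"
    unfolding laurent_of_poly_def by (simp add: poly_altdef degree_map_poly coeff_map_poly)
  then have "fls_nth (laurent_of_poly n * f) i =
      (\<Sum>m\<le>degree n. fls_nth (fls_const (coeff n m) * (fls_X_inv ^ m * f)) i)"
    by (simp add: sum_distrib_right fls_nth_sum mult.assoc)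
  also have "\<dots> = (\<Sum>m\<le>degree n. coeff n m * fls_nth f (i + int m))"
    by (simp add: fls_X_inv_power_times_conv_shift)
  also have "\<dots> = (\<Sum>m\<le>N. coeff n m * fls_nth f (i + int m))"
    using assms by (intro sum.mono_neutral_left) (auto simp: coeff_eq_0)
  finally show ?thesis .
qed

text \<open>Multiplying by a denominator b would give a polynomial in t, without negative powers.
  But the gaps of the series outgrow the degree of b, so some negative power has the isolated
  coefficient \<open>lead_coeff b * h j\<close>.\<close>

lemma lacunary_series_irrational:
  fixes h :: "nat \<Rightarrow> 'p::prime_card mod_ring"
  assumes "\<And>N. \<exists>j\<ge>N. h j \<noteq> 0"
  shows "lacunary_series h \<notin> rational_laurent"
proof
  let ?p = "CARD('p)"
  have p1: "?p > 1" by (rule CARD_prime_gt_1)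
  assume "lacunary_series h \<in> rational_laurent"
  then obtain a b where ab: "lacunary_series h = laurent_of_poly a / laurent_of_poly b" "b \<noteq> 0"
    by (auto simp: rational_laurent_def)
  have "laurent_of_poly b \<noteq> 0"
  proof
    assume "laurent_of_poly b = 0"
    then have "fls_nth (laurent_of_poly b) (- int (degree b)) = 0" by simp
    then show False using ab(2) by (simp add: fls_nth_laurent_of_poly)
  qed
  then have eq: "laurent_of_poly b * lacunary_series h = laurent_of_poly a"
    using ab(1) by simp
  define d where "d = degree b"
  obtain j where j: "j \<ge> Suc (Suc d)" "h j \<noteq> 0" using assms by blast
  define i where "i = ?p ^ j - d"
  have gap: "?p ^ (j - 1) + d < ?p ^ j"
  proof -
    have "d < ?p ^ (j - 1)" using j(1) power_gt_expt[of ?p "j - 1"] p1 by linarith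
    moreover have "2 * ?p ^ (j - 1) \<le> ?p ^ j" using p1 j(1) by (cases j) auto
    ultimately show ?thesis by linarith
  qed
  have "lacunary h (i + m) = 0" if "m < d" for m
  proof (rule lacunary_eq_0)
    fix l
    have "?p ^ (j - 1) < i + m" "i + m < ?p ^ j" using gap that by (auto simp: i_def)
    then show "i + m \<noteq> ?p ^ l"
      using p1 by (cases "l \<le> j - 1") (auto dest: power_increasing[of l "j - 1" ?p] power_increasing[of j l ?p])
  qed
  then have "(\<Sum>m\<le>d. coeff b m * lacunary h (i + m)) =
      (\<Sum>m\<le>d. if m = d then coeff b d * lacunary h (i + d) else 0)"
    by (intro sum.cong refl) auto
  also have "\<dots> = lead_coeff b * h j"
    using gap by (simp add: i_def lacunary_power d_def)
  also have "\<dots> \<noteq> 0" using ab(2) j(2) by simp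
  finally have nz: "(\<Sum>m\<le>d. coeff b m * lacunary h (i + m)) \<noteq> 0" .
  have "fls_nth (lacunary_series h) (int i + 1 + int m) = lacunary h (i + m)" for m
    using fls_nth_lacunary_series[of h "i + m"] by (simp add: algebra_simps)
  then have "fls_nth (laurent_of_poly b * lacunary_series h) (int i + 1) \<noteq> 0"
    using nz fls_nth_laurent_of_poly_mult[of b d "lacunary_series h" "int i + 1"] by (simp add: d_def)
  then show False unfolding eq by (simp add: fls_nth_laurent_of_poly)
qed

text \<open>The coefficient of \<open>t^(-1)\<close> in n times the lacunary series, as a linear
  functional of n. No term beyond \<open>degree n\<close> is lost, again because
  \<open>i < p^i\<close>.\<close>

definition lacunary_pairing :: "(nat \<Rightarrow> 'p::prime_card mod_ring) \<Rightarrow> 'p mod_ring poly \<Rightarrow> 'p mod_ring"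
  where "lacunary_pairing h n = (\<Sum>i\<le>degree n. coeff n (CARD('p) ^ i) * h i)"

lemma lacunary_pairing_eq:
  fixes n :: "'p::prime_card mod_ring poly"
  assumes "degree n \<le> N"
  shows "lacunary_pairing h n = (\<Sum>i\<le>N. coeff n (CARD('p) ^ i) * h i)"
  unfolding lacunary_pairing_def
proof (rule sum.mono_neutral_left)
  show "\<forall>i\<in>{..N} - {..degree n}. coeff n (CARD('p) ^ i) * h i = 0"
  proof
    fix i assume "i \<in> {..N} - {..degree n}"
    moreover have "i < CARD('p) ^ i" by (rule power_gt_expt) (use CARD_prime_gt_1 in auto)
    ultimately show "coeff n (CARD('p) ^ i) * h i = 0" by (simp add: coeff_eq_0)
  qed
qed (use assms in auto)

lemma lacunary_pairing_sum:
  assumes "finite A"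
  shows "lacunary_pairing h (\<Sum>a\<in>A. smult (c a) (f a)) = (\<Sum>a\<in>A. c a * lacunary_pairing h (f a))"
proof -
  define N where "N = Max (insert 0 (degree ` f ` A))"
  have N: "degree (f a) \<le> N" if "a \<in> A" for a
    unfolding N_def using assms that by (intro Max_ge) auto
  have "degree (\<Sum>a\<in>A. smult (c a) (f a)) \<le> N"
    using assms N by (intro degree_sum_le) (auto intro: order.trans[OF degree_smult_le])
  then show ?thesis
    by (simp add: lacunary_pairing_eq[of _ N] N coeff_sum sum_distrib_left sum_distrib_right
        sum.swap[of _ A] mult.assoc cong: sum.cong)
qed

lemma poly_frobenius:
  fixes u :: "'p::prime_card mod_ring poly"
  shows "u ^ (CARD('p) ^ j) = (\<Sum>i\<le>degree u. monom (coeff u i) (i * CARD('p) ^ j))"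
proof -
  have "u ^ (CARD('p) ^ j) = (\<Sum>i\<le>degree u. monom (coeff u i) i) ^ (CARD('p) ^ j)"
    by (simp add: poly_as_sum_of_monoms)
  also have "\<dots> = (\<Sum>i\<le>degree u. monom (coeff u i) i ^ (CARD('p) ^ j))"
    by (rule freshmans_dream_sum') (use prime_card[where 'a='p] in auto)
  finally show ?thesis
    by (simp add: monom_power finite_field_power_card_power_eq_same[of _ j])
qed

text \<open>Frobenius fixes the coefficients of u and multiplies its exponents by
  \<open>p^j\<close>, so the coefficient at \<open>p^l\<close> comes from \<open>p^(l-j)\<close>.
  Powers of p are thus only shifted, which is why the series is supported there.\<close>

lemma lacunary_pairing_frobenius:
  fixes u :: "'p::prime_card mod_ring poly"
  shows "lacunary_pairing h (u ^ (CARD('p) ^ j)) = (\<Sum>i\<le>degree u. coeff u (CARD('p) ^ i) * h (i + j))"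
proof -
  let ?p = "CARD('p)"
  have p1: "?p > 1" by (rule CARD_prime_gt_1)
  have co: "coeff (u ^ (?p ^ j)) (?p ^ l) = (if j \<le> l then coeff u (?p ^ (l - j)) else 0)" for l
  proof -
    have "coeff (u ^ (?p ^ j)) (?p ^ l) = (\<Sum>i\<le>degree u. if i * ?p ^ j = ?p ^ l then coeff u i else 0)"
      by (simp add: poly_frobenius coeff_sum)
    also have "\<dots> = (\<Sum>i\<le>degree u. if j \<le> l \<and> i = ?p ^ (l - j) then coeff u i else 0)"
    proof (intro sum.cong refl)
      fix i
      have "i * ?p ^ j = ?p ^ l \<longleftrightarrow> j \<le> l \<and> i = ?p ^ (l - j)"
      proof
        assume eq: "i * ?p ^ j = ?p ^ l"
        then have "?p ^ j dvd ?p ^ l" by (metis dvd_triv_right)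
        then have "j \<le> l" using p1 by (simp add: power_dvd_imp_le)
        then have "?p ^ l = ?p ^ (l - j) * ?p ^ j" by (simp flip: power_add)
        with eq p1 \<open>j \<le> l\<close> show "j \<le> l \<and> i = ?p ^ (l - j)" by auto
      qed (simp flip: power_add)
      then show "(if i * ?p ^ j = ?p ^ l then coeff u i else 0) =
          (if j \<le> l \<and> i = ?p ^ (l - j) then coeff u i else 0)" by simp
    qed
    also have "\<dots> = (if j \<le> l then coeff u (?p ^ (l - j)) else 0)"
      by (auto simp: coeff_eq_0)
    finally show ?thesis .
  qed
  define N where "N = degree (u ^ (?p ^ j)) + degree u"
  have "lacunary_pairing h (u ^ (?p ^ j)) = (\<Sum>l\<le>N + j. coeff (u ^ (?p ^ j)) (?p ^ l) * h l)"
    by (rule lacunary_pairing_eq) (simp add: N_def)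
  also have "\<dots> = (\<Sum>l\<in>{j..N + j}. coeff u (?p ^ (l - j)) * h l)"
    by (intro sum.mono_neutral_cong_right) (auto simp: co)
  also have "\<dots> = (\<Sum>i\<le>N. coeff u (?p ^ i) * h (i + j))"
    by (rule sum.reindex_bij_witness[of _ "\<lambda>i. i + j" "\<lambda>l. l - j"]) auto
  also have "\<dots> = (\<Sum>i\<le>degree u. coeff u (?p ^ i) * h (i + j))"
    using lacunary_pairing_eq[of u N "\<lambda>i. h (i + j)"] lacunary_pairing_eq[of u "degree u" "\<lambda>i. h (i + j)"]
    by (simp add: N_def)
  finally show ?thesis .
qed

lemma torus_coeff_lacunary:
  fixes n :: "'p::prime_card mod_ring poly"
  shows "torus_coeff (to_torus (laurent_of_poly n * lacunary_series h)) 0 = lacunary_pairing h n"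
proof -
  let ?p = "CARD('p)"
  have p1: "?p > 1" by (rule CARD_prime_gt_1)
  have "torus_coeff (to_torus (laurent_of_poly n * lacunary_series h)) 0 =
      (\<Sum>m\<le>degree n. coeff n m * lacunary h m)"
    using fls_nth_lacunary_series[of h]
    by (simp add: torus_coeff_to_torus fls_nth_laurent_of_poly_mult[of n "degree n"] add.commute)
  also have "\<dots> = (\<Sum>m\<le>degree n. \<Sum>j\<le>degree n. if m = ?p ^ j then coeff n m * h j else 0)"
  proof (intro sum.cong refl)
    fix m assume m: "m \<in> {..degree n}"
    have "lacunary h m = (\<Sum>j\<le>degree n. if m = ?p ^ j then h j else 0)"
      unfolding lacunary_def
    proof (rule sum.mono_neutral_left)
      have "m \<noteq> ?p ^ j" if "j > m" for j using power_gt_expt[of ?p j] p1 that by auto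
      then show "\<forall>j\<in>{..degree n} - {..m}. (if m = ?p ^ j then h j else 0) = 0" by auto
    qed (use m in auto)
    then show "coeff n m * lacunary h m = (\<Sum>j\<le>degree n. if m = ?p ^ j then coeff n m * h j else 0)"
      by (simp add: sum_distrib_left if_distrib cong: if_cong)
  qed
  also have "\<dots> = (\<Sum>j\<le>degree n. \<Sum>m\<le>degree n. if m = ?p ^ j then coeff n m * h j else 0)"
    by (rule sum.swap)
  also have "\<dots> = lacunary_pairing h n"
    unfolding lacunary_pairing_def by (intro sum.cong refl) (auto simp: coeff_eq_0)
  finally show ?thesis .
qed

text \<open>These sets are additive groups, so translation by n fixes them as soon as
  \<open>N >= degree n\<close>.\<close>

lemma folner_sequence_degree:
  "folner_sequence (\<lambda>N. {n :: 'a::{finite,field} poly. degree n \<le> N})"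
  unfolding folner_sequence_def
proof (intro conjI allI)
  fix N
  have "{n :: 'a poly. degree n \<le> N} \<subseteq> Poly ` {l. length l \<le> Suc N}"
  proof
    fix n :: "'a poly" assume "n \<in> {n. degree n \<le> N}"
    then have "length (coeffs n) \<le> Suc N"
      by (cases "n = 0") (auto simp: length_coeffs_degree)
    then show "n \<in> Poly ` {l. length l \<le> Suc N}"
      by (intro image_eqI[of _ _ "coeffs n"]) auto
  qed
  moreover have "finite {l :: 'a list. length l \<le> Suc N}"
    using finite_lists_length_le[of "UNIV :: 'a set" "Suc N"] by simp
  ultimately show "finite {n :: 'a poly. degree n \<le> N}" by (meson finite_imageI finite_subset)
  show "{n :: 'a poly. degree n \<le> N} \<noteq> {}" by (auto intro: exI[of _ 0])
next
  fix n :: "'a poly"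
  have "(\<lambda>x. x + n) ` {n. degree n \<le> N} = {n. degree n \<le> N}" if "degree n \<le> N" for N
  proof
    show "{n. degree n \<le> N} \<subseteq> (\<lambda>x. x + n) ` {n. degree n \<le> N}"
    proof
      fix m :: "'a poly" assume "m \<in> {n. degree n \<le> N}"
      then show "m \<in> (\<lambda>x. x + n) ` {n. degree n \<le> N}"
        using that by (intro image_eqI[of _ _ "m - n"]) (auto intro: degree_diff_le)
    qed
  qed (use that in \<open>auto intro: degree_add_le\<close>)
  then have "eventually (\<lambda>N. real (card (sym_diff ((\<lambda>x. x + n) ` {n. degree n \<le> N}) {n. degree n \<le> N})) /
      real (card {n :: 'a poly. degree n \<le> N}) = 0) sequentially"
    by (intro eventually_sequentiallyI[of "degree n"]) simp
  then show "(\<lambda>N. real (card (sym_diff ((\<lambda>x. x + n) ` {n. degree n \<le> N}) {n. degree n \<le> N})) /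
      real (card {n :: 'a poly. degree n \<le> N})) \<longlonglongrightarrow> 0"
    by (rule tendsto_eventually)
qed

text \<open>The set where the coefficient of \<open>t^(-1)\<close> vanishes is open and closed, so
  its indicator is an admissible test function: its averages along the sequence are 1, its integral
  is 1/p.\<close>

lemma not_well_distributed_if_coeff_zero:
  fixes a :: "'p::prime_card mod_ring poly \<Rightarrow> 'p mod_ring fls"
  assumes "\<And>n. torus_coeff (to_torus (a n)) 0 = 0"
  shows "\<not> well_distributed a"
proof
  assume wd: "well_distributed a"
  define Z where "Z = cylinder 1 (\<lambda>_. 0 :: 'p mod_ring)"
  define g :: "'p mod_ring laurent_torus \<Rightarrow> complex" where "g = (\<lambda>x. of_real (indicator Z x))"
  define \<Phi> where "\<Phi> = (\<lambda>N. {n :: 'p mod_ring poly. degree n \<le> N})"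
  have haar: "is_haar_probability (haar_probability :: 'p mod_ring laurent_torus measure)"
    by (rule is_haar_probability_haar_probability)
  interpret prob_space "haar_probability :: 'p mod_ring laurent_torus measure"
    using haar by (simp add: is_haar_probability_def)
  have sets: "sets (haar_probability :: 'p mod_ring laurent_torus measure) = sets borel"
    using haar by (simp add: is_haar_probability_def)
  have F: "folner_sequence \<Phi>" unfolding \<Phi>_def by (rule folner_sequence_degree)
  have "continuous_on UNIV g"
    unfolding continuous_on_open_vimage[OF open_UNIV] open_torus_iff
    by (auto simp: g_def Z_def cylinder_def indicator_def intro!: exI[of _ 1])
  with wd F have "(\<lambda>N. (\<Sum>n\<in>\<Phi> N. g (to_torus (a n))) / of_nat (card (\<Phi> N)))
      \<longlonglongrightarrow> (\<integral>x. g x \<partial>haar_probability)"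
    unfolding well_distributed_def by blast
  moreover have "g (to_torus (a n)) = 1" for n
    using assms by (simp add: g_def Z_def cylinder_def)
  moreover have "card (\<Phi> N) \<noteq> 0" for N
    using F by (auto simp: folner_sequence_def card_eq_0_iff)
  ultimately have "(\<lambda>_::nat. 1) \<longlonglongrightarrow> (\<integral>x. g x \<partial>haar_probability)" by simp
  then have "(\<integral>x. g x \<partial>haar_probability) = 1" by (simp add: LIMSEQ_const_iff)
  moreover have "(\<integral>x. g x \<partial>haar_probability) = of_real (measure haar_probability Z)"
    unfolding g_def integral_complex_of_real using sets_eq_imp_space_eq[OF sets] by simp
  moreover have "measure haar_probability Z = 1 / real CARD('p)"
    using emeasure_haar_cylinder[OF haar, of 1 "\<lambda>_. 0"]
    by (simp add: Z_def measure_def)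
  ultimately have "1 / real CARD('p) = 1" by (metis of_real_eq_1_iff)
  then show False using CARD_prime_gt_1[where 'p='p] by simp
qed

text \<open>If all reduced coefficients of $bQ$ vanish, then $h_j = \mathrm{Tr}(w\, b^{1/p^j})$ satisfies
  $\sum_j c_{rp^j} h_{i+j} = 0$ for the coefficients $c_m$ of $Q$, and so $t^{-1}$ never occurs in
  $Q(n) \sum_j h_j t^{-p^j-1}$.\<close>

lemma good_imp_reduced_coeff_nonzero:
  fixes Q :: "'p::prime_card mod_ring poly"
  assumes good: "good_for_irrational_equidistribution (map_poly (\<lambda>c. [:c:]) Q)"
    and k: "k > 0" and b: "b \<in> galois_field k" "b \<noteq> 0"
  shows "\<exists>r\<in>{1..degree Q}. reduced_coeff k (degree Q) (\<lambda>m. b * to_ac (coeff Q m)) r \<noteq> 0"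
proof (rule ccontr)
  let ?p = "CARD('p)" and ?D = "degree Q"
  let ?R = "{r. r \<in> {1..?D} \<and> \<not> ?p dvd r}"
  have p1: "?p > 1" by (rule CARD_prime_gt_1)
  assume neg: "\<not> ?thesis"
  have red: "(\<Sum>j\<le>?D. to_ac (coeff Q (r * ?p ^ j)) * frob_root k j b) = 0" if "r \<in> ?R" for r
  proof -
    have "reduced_coeff k ?D (\<lambda>m. b * to_ac (coeff Q m)) r = 0" using neg that by blast
    moreover have "frob_root k j (b * to_ac c) = to_ac c * frob_root k j b" for j and c :: "'p mod_ring"
      by (subst mult.commute) (rule frob_root_to_ac_mult)
    ultimately show ?thesis using that by (simp add: reduced_coeff_def)
  qed
  obtain w0 :: "'p mod_ring alg_closure" where w0: "w0 \<in> galois_field k" "field_trace k w0 \<noteq> 0"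
    using field_trace_nonzero[OF k] by blast
  \<comment> \<open>The multiplier \<open>w\<close> is needed because all conjugates of b have the
    same trace, which may be 0; \<open>w * b\<close> has nonzero trace.\<close>
  define w where "w = w0 / b"
  have w: "w \<in> galois_field k" "w * b = w0"
    using w0 b by (auto simp: w_def divide_inverse intro!: galois_field_mult galois_field_inverse)
  define h where "h = (\<lambda>j. field_trace k (w * frob_root k j b))"
  note mem = galois_field_intros frob_root_mem w b
  have "lacunary_series h \<notin> rational_laurent"
  proof (rule lacunary_series_irrational)
    \<comment> \<open>At multiples of k the conjugate is b itself, so \<open>h (k * N)\<close> is
      the trace of \<open>w * b\<close>.\<close>
    show "\<exists>j\<ge>N. h j \<noteq> 0" for N
      using k w w0 b by (intro exI[of _ "k * N"]) (simp add: h_def frob_root_period)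
  qed
  with good have wd: "well_distributed (\<lambda>n. laurent_of_poly (poly (map_poly (\<lambda>c. [:c:]) Q) n) * lacunary_series h)"
    unfolding good_for_irrational_equidistribution_def by blast
  \<comment> \<open>Sending y to the trace of \<open>w * frob_root k i y\<close> is linear over the
    prime field; applied to the relation \<open>red\<close> it gives the recurrence for every
    \<open>i\<close>.\<close>
  have rec: "(\<Sum>j\<le>?D. coeff Q (r * ?p ^ j) * h (i + j)) = 0" if "r \<in> ?R" for r i
  proof -
    have "(\<Sum>j\<le>?D. coeff Q (r * ?p ^ j) * h (i + j)) =
        field_trace k (\<Sum>j\<le>?D. to_ac (coeff Q (r * ?p ^ j)) * (w * frob_root k (i + j) b))"
      by (simp add: h_def field_trace_sum field_trace_scale mem)
    also have "(\<Sum>j\<le>?D. to_ac (coeff Q (r * ?p ^ j)) * (w * frob_root k (i + j) b)) =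
        w * frob_root k i (\<Sum>j\<le>?D. to_ac (coeff Q (r * ?p ^ j)) * frob_root k j b)"
      by (simp add: frob_root_sum frob_root_to_ac_mult frob_root_add sum_distrib_left mult.left_commute)
    finally show ?thesis using red[OF that] by simp
  qed
  have "lacunary_pairing h (poly (map_poly (\<lambda>c. [:c:]) Q) n) = 0" for n
  proof -
    have "poly (map_poly (\<lambda>c. [:c:]) Q) n = (\<Sum>m\<le>?D. smult (coeff Q m) (n ^ m))"
      by (simp add: poly_altdef degree_map_poly coeff_map_poly)
    then have "lacunary_pairing h (poly (map_poly (\<lambda>c. [:c:]) Q) n) =
        (\<Sum>m\<le>?D. coeff Q m * lacunary_pairing h (n ^ m))"
      by (simp add: lacunary_pairing_sum)
    \<comment> \<open>The constant term of Q is invisible: the polynomial 1 has no coefficient at an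
      exponent \<open>p^i >= 1\<close>.\<close>
    also have "\<dots> = (\<Sum>m=1..?D. coeff Q m * lacunary_pairing h (n ^ m))"
      using p1 by (intro sum.mono_neutral_right) (auto simp: lacunary_pairing_def not_less_eq_eq)
    also have "\<dots> = (\<Sum>r\<in>?R. \<Sum>j\<le>?D. coeff Q (r * ?p ^ j) * lacunary_pairing h (n ^ (r * ?p ^ j)))"
      by (rule sum_split_prime_powers[OF prime_card]) (simp add: coeff_eq_0)
    also have "\<dots> = (\<Sum>r\<in>?R. \<Sum>i\<le>degree (n ^ r). coeff (n ^ r) (?p ^ i) *
        (\<Sum>j\<le>?D. coeff Q (r * ?p ^ j) * h (i + j)))"
      unfolding power_mult lacunary_pairing_frobenius sum_distrib_left
      by (subst (2) sum.swap) (simp add: mult.left_commute)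
    also have "\<dots> = 0" using rec by simp
    finally show ?thesis .
  qed
  then show False
    using wd not_well_distributed_if_coeff_zero by (metis torus_coeff_lacunary)
qed

section \<open>Weyl sums over finite fields\<close>

text \<open>Expand the square of the modulus and substitute y = z + h; in a finite group no boundary
  terms arise.\<close>

lemma van_der_corput_field:
  fixes f :: "'p::prime_card mod_ring alg_closure \<Rightarrow> 'p mod_ring alg_closure"
  assumes k: "k > 0" and f: "\<And>z. z \<in> galois_field k \<Longrightarrow> f z \<in> galois_field k"
  shows "(norm (\<Sum>z\<in>galois_field k. field_char k (f z)))\<^sup>2 \<le>
    (\<Sum>h\<in>galois_field k. norm (\<Sum>z\<in>galois_field k. field_char k (f (z + h) - f z)))"
proof -
  let ?F = "galois_field k :: 'p mod_ring alg_closure set"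
  let ?S = "\<Sum>z\<in>?F. field_char k (f z)"
  have "of_real ((norm ?S)\<^sup>2) = ?S * cnj ?S"
    by (rule complex_norm_square)
  also have "\<dots> = (\<Sum>z\<in>?F. \<Sum>y\<in>?F. field_char k (f y) * cnj (field_char k (f z)))"
    by (simp add: sum_product) (rule sum.swap)
  also have "\<dots> = (\<Sum>z\<in>?F. \<Sum>h\<in>?F. field_char k (f (z + h) - f z))"
  proof (rule sum.cong[OF refl])
    fix z assume z: "z \<in> ?F"
    have "(\<Sum>y\<in>?F. field_char k (f y) * cnj (field_char k (f z))) = (\<Sum>y\<in>?F. field_char k (f y - f z))"
      using f z by (intro sum.cong refl) (simp add: field_char_diff)
    also have "\<dots> = (\<Sum>h\<in>?F. field_char k (f (z + h) - f z))"
      by (rule sum.reindex_bij_witness[of _ "\<lambda>h. z + h" "\<lambda>y. y - z"])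
         (auto intro!: galois_field_diff galois_field_add z)
    finally show "(\<Sum>y\<in>?F. field_char k (f y) * cnj (field_char k (f z))) =
      (\<Sum>h\<in>?F. field_char k (f (z + h) - f z))" .
  qed
  also have "\<dots> = (\<Sum>h\<in>?F. \<Sum>z\<in>?F. field_char k (f (z + h) - f z))" by (rule sum.swap)
  finally have eq: "of_real ((norm ?S)\<^sup>2) = (\<Sum>h\<in>?F. \<Sum>z\<in>?F. field_char k (f (z + h) - f z))" .
  have "(norm ?S)\<^sup>2 = norm (of_real ((norm ?S)\<^sup>2) :: complex)"
    by (simp only: norm_of_real abs_power2)
  also have "\<dots> \<le> (\<Sum>h\<in>?F. norm (\<Sum>z\<in>?F. field_char k (f (z + h) - f z)))"
    unfolding eq by (rule norm_sum)
  finally show ?thesis .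
qed

text \<open>The coefficient of \<open>z^j\<close> in f(z + h) - f(z), where f is the sum of the
  \<open>\<beta> r * z^r\<close>. It is kept as a polynomial in h so that exceptional shifts can be
  counted as roots; \<open>j < r\<close> drops what f(z) cancels.\<close>

definition diff_poly :: "nat \<Rightarrow> (nat \<Rightarrow> 'a::comm_ring_1) \<Rightarrow> nat \<Rightarrow> 'a poly" where
  "diff_poly D \<beta> j =
    (\<Sum>r=1..Suc D. if j < r then monom (\<beta> r * of_nat (r choose j)) (r - j) else 0)"

lemma poly_diff_poly:
  "poly (diff_poly D \<beta> j) h =
    (\<Sum>r=1..Suc D. if j < r then \<beta> r * of_nat (r choose j) * h ^ (r - j) else 0)"
  by (simp add: diff_poly_def poly_sum poly_monom if_distrib[of "\<lambda>q. poly q h"] cong: if_cong)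

lemma diff_poly_eq_0: "j > D \<Longrightarrow> diff_poly D \<beta> j = 0"
  unfolding diff_poly_def by (intro sum.neutral) auto

lemma degree_diff_poly: "degree (diff_poly D \<beta> j) \<le> Suc D"
  unfolding diff_poly_def
  by (intro degree_sum_le) (auto intro!: order.trans[OF degree_monom_le])

lemma diff_poly_top: "diff_poly D \<beta> D = monom (\<beta> (Suc D) * of_nat (Suc D)) 1"
proof -
  have "diff_poly D \<beta> D = (\<Sum>r=1..Suc D. if r = Suc D then monom (\<beta> (Suc D) * of_nat (Suc D)) 1 else 0)"
    unfolding diff_poly_def by (intro sum.cong refl) auto
  then show ?thesis by simp
qed

lemma sum_powers_shift:
  fixes \<beta> :: "nat \<Rightarrow> 'a::comm_ring_1"
  shows "(\<Sum>r=1..Suc D. \<beta> r * (z + h) ^ r) - (\<Sum>r=1..Suc D. \<beta> r * z ^ r) =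
    poly (diff_poly D \<beta> 0) h + (\<Sum>j=1..D. poly (diff_poly D \<beta> j) h * z ^ j)"
proof -
  have "(\<Sum>r=1..Suc D. \<beta> r * (z + h) ^ r) - (\<Sum>r=1..Suc D. \<beta> r * z ^ r) =
      (\<Sum>r=1..Suc D. \<beta> r * ((z + h) ^ r - z ^ r))"
    by (simp add: sum_subtractf right_diff_distrib)
  also have "\<dots> = (\<Sum>r=1..Suc D. \<Sum>j\<le>D. if j < r then \<beta> r * of_nat (r choose j) * h ^ (r - j) * z ^ j else 0)"
  proof (intro sum.cong refl)
    fix r assume r: "r \<in> {1..Suc D}"
    have "(z + h) ^ r - z ^ r = (\<Sum>j<r. of_nat (r choose j) * z ^ j * h ^ (r - j))"
      unfolding binomial_ring by (simp flip: lessThan_Suc_atMost)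
    then have "\<beta> r * ((z + h) ^ r - z ^ r) = (\<Sum>j<r. \<beta> r * of_nat (r choose j) * h ^ (r - j) * z ^ j)"
      by (simp add: sum_distrib_left mult_ac)
    also have "\<dots> = (\<Sum>j\<le>D. if j < r then \<beta> r * of_nat (r choose j) * h ^ (r - j) * z ^ j else 0)"
      using r by (intro sum.mono_neutral_cong_left) auto
    finally show "\<beta> r * ((z + h) ^ r - z ^ r) =
        (\<Sum>j\<le>D. if j < r then \<beta> r * of_nat (r choose j) * h ^ (r - j) * z ^ j else 0)" .
  qed
  also have "\<dots> = (\<Sum>j\<le>D. \<Sum>r=1..Suc D. if j < r then \<beta> r * of_nat (r choose j) * h ^ (r - j) * z ^ j else 0)"
    by (rule sum.swap)
  also have "\<dots> = (\<Sum>j\<le>D. poly (diff_poly D \<beta> j) h * z ^ j)"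
    unfolding poly_diff_poly sum_distrib_right
    by (intro sum.cong refl) simp
  also have "{..D} = insert 0 {1..D}" by auto
  finally show ?thesis by simp
qed

lemma of_nat_CARD_power_alg_closure:
  "i > 0 \<Longrightarrow> of_nat (CARD('p) ^ i) = (0 :: 'p::prime_card mod_ring alg_closure)"
  using of_nat_CHAR[where 'a="'p mod_ring alg_closure"] by (simp add: power_0_left)

text \<open>With $D = p^e m$ and $p \nmid m$, the $p^e$-th power of the reduced coefficient at $m$ of the
  differenced polynomial is a polynomial in the shift $h$. All its terms other than
  $(D+1)\beta_{D+1} h$ are $p$-th powers, so its derivative is a nonzero constant.\<close>

lemma card_degenerate_shifts:
  fixes \<beta> :: "nat \<Rightarrow> 'p::prime_card mod_ring alg_closure"
  assumes k: "k > 0" and D: "D > 0" and mem: "\<And>r. \<beta> r \<in> galois_field k"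
    and top: "\<beta> (Suc D) \<noteq> 0" "\<not> CARD('p) dvd Suc D"
  shows "card {h \<in> galois_field k. \<forall>r\<in>{1..D}. reduced_coeff k D (\<lambda>j. poly (diff_poly D \<beta> j) h) r = 0}
    \<le> (Suc D)\<^sup>2"
proof -
  let ?p = "CARD('p)" and ?d = "\<lambda>h j. poly (diff_poly D \<beta> j) h"
  have p: "prime ?p" "?p > 1" using prime_card CARD_prime_gt_1 by auto
  define e where "e = multiplicity ?p D"
  define m where "m = D div ?p ^ e"
  have Deq: "D = m * ?p ^ e" by (simp add: m_def e_def multiplicity_dvd)
  have mp: "\<not> ?p dvd m" unfolding m_def e_def using D p by (intro multiplicity_decompose) auto
  have m1: "m \<ge> 1" using Deq D by (cases m) auto
  have pe: "?p ^ e \<le> D" using Deq m1 by (metis mult_le_mono1 mult_1)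
  then have eD: "e \<le> D" using power_gt_expt[of ?p e] p by auto
  have mD: "m \<le> D" using Deq p by simp
  define T where "T = (\<Sum>j\<le>e. diff_poly D \<beta> (m * ?p ^ j) ^ (?p ^ (e - j)))"
  have mem_d: "?d h j \<in> galois_field k" if "h \<in> galois_field k" for h j
    unfolding poly_diff_poly using mem that by (auto intro!: galois_field_intros)
  have "pderiv T = (\<Sum>j\<le>e. if j = e then [:\<beta> (Suc D) * of_nat (Suc D):] else 0)"
    unfolding T_def pderiv_sum
  proof (intro sum.cong refl)
    fix j assume "j \<in> {..e}"
    then consider "j = e" | "j < e" by fastforce
    then show "pderiv (diff_poly D \<beta> (m * ?p ^ j) ^ (?p ^ (e - j))) =
        (if j = e then [:\<beta> (Suc D) * of_nat (Suc D):] else 0)"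
    proof cases
      case 1
      then show ?thesis using Deq by (simp add: diff_poly_top pderiv_monom monom_0 mult.commute)
    next
      case 2
      then have "of_nat (?p ^ (e - j)) = (0 :: 'p mod_ring alg_closure)"
        by (intro of_nat_CARD_power_alg_closure) simp
      with 2 show ?thesis unfolding pderiv_power by (simp del: of_nat_power)
    qed
  qed
  also have "\<dots> = [:\<beta> (Suc D) * of_nat (Suc D):]" by simp
  also have "\<dots> \<noteq> 0"
    using top by (simp add: of_nat_eq_0_iff_char_dvd del: of_nat_Suc)
  finally have T0: "T \<noteq> 0" by auto
  \<comment> \<open>Since \<open>p^e <= D\<close>, the resulting bound depends on D alone, not on k
    or \<beta>.\<close>
  have "degree T \<le> Suc D * ?p ^ e"
    unfolding T_def
  proof (rule degree_sum_le)
    fix j assume "j \<in> {..e}"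
    have "degree (diff_poly D \<beta> (m * ?p ^ j) ^ ?p ^ (e - j)) \<le> degree (diff_poly D \<beta> (m * ?p ^ j)) * ?p ^ (e - j)"
      by (rule degree_power_le)
    also have "\<dots> \<le> Suc D * ?p ^ e"
      using p by (intro mult_mono degree_diff_poly power_increasing) auto
    finally show "degree (diff_poly D \<beta> (m * ?p ^ j) ^ ?p ^ (e - j)) \<le> Suc D * ?p ^ e" .
  qed simp
  also have "\<dots> \<le> (Suc D)\<^sup>2" unfolding power2_eq_square using pe by (intro mult_mono) auto
  finally have degT: "degree T \<le> (Suc D)\<^sup>2" .
  have "{h \<in> galois_field k. \<forall>r\<in>{1..D}. reduced_coeff k D (?d h) r = 0} \<subseteq> {h. poly T h = 0}"
  proof clarify
    fix h :: "'p mod_ring alg_closure"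
    assume h: "h \<in> galois_field k" "\<forall>r\<in>{1..D}. reduced_coeff k D (?d h) r = 0"
    have "poly T h = (\<Sum>j\<le>e. (frob_root k j (?d h (m * ?p ^ j))) ^ (?p ^ e))"
    proof -
      have "?d h (m * ?p ^ j) ^ (?p ^ (e - j)) = frob_root k j (?d h (m * ?p ^ j)) ^ (?p ^ e)"
        if "j \<le> e" for j
      proof -
        have "frob_root k j (?d h (m * ?p ^ j)) ^ (?p ^ e) =
            (frob_root k j (?d h (m * ?p ^ j)) ^ (?p ^ j)) ^ (?p ^ (e - j))"
          using that by (simp flip: power_mult power_add)
        then show ?thesis using frob_root_pow[OF k mem_d[OF h(1)]] by simp
      qed
      then show ?thesis by (simp add: T_def poly_sum)
    qed
    also have "\<dots> = (\<Sum>j\<le>e. frob_root k j (?d h (m * ?p ^ j))) ^ (?p ^ e)"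
      by (rule frobenius_sum[symmetric])
    \<comment> \<open>For j > e the exponent \<open>m * p^j\<close> exceeds D, where the differenced
      polynomial has no terms.\<close>
    also have "(\<Sum>j\<le>e. frob_root k j (?d h (m * ?p ^ j))) = (\<Sum>j\<le>D. frob_root k j (?d h (m * ?p ^ j)))"
    proof (rule sum.mono_neutral_left)
      have "m * ?p ^ j > D" if "j > e" for j
        using that m1 p unfolding Deq by (intro mult_strict_left_mono power_strict_increasing) auto
      then show "\<forall>j\<in>{..D} - {..e}. frob_root k j (?d h (m * ?p ^ j)) = 0"
        by (auto simp: diff_poly_eq_0)
    qed (use eD in auto)
    also have "\<dots> = reduced_coeff k D (?d h) m" using mp by (simp add: reduced_coeff_def)
    also have "\<dots> = 0" using h(2) m1 mD by simp
    finally show "poly T h = 0" using p by simp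
  qed
  then have "card {h \<in> galois_field k. \<forall>r\<in>{1..D}. reduced_coeff k D (?d h) r = 0} \<le> card {h. poly T h = 0}"
    by (intro card_mono poly_roots_finite T0)
  also have "\<dots> \<le> degree T" by (rule card_poly_roots_bound[OF T0])
  finally show ?thesis using degT by linarith
qed

text \<open>Shifts whose differenced polynomial has a nonzero reduction fall under the induction
  hypothesis, which applies because reducing again restores exponents prime to p. The at most
  \<open>(D+1)^2\<close> other shifts are bounded trivially.\<close>

lemma weyl_sum_step:
  fixes \<beta> :: "nat \<Rightarrow> 'p::prime_card mod_ring alg_closure"
  assumes k: "k > 0" and D: "D > 0" and mem: "\<And>r. \<beta> r \<in> galois_field k"
    and top: "\<beta> (Suc D) \<noteq> 0" "\<not> CARD('p) dvd Suc D" and \<epsilon>: "\<epsilon> \<ge> 0"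
    and IH: "\<And>\<gamma> :: nat \<Rightarrow> 'p mod_ring alg_closure. (\<And>r. \<gamma> r \<in> galois_field k) \<Longrightarrow>
      (\<And>r. CARD('p) dvd r \<Longrightarrow> \<gamma> r = 0) \<Longrightarrow> (\<exists>r\<in>{1..D}. \<gamma> r \<noteq> 0) \<Longrightarrow>
      norm (\<Sum>z\<in>galois_field k. field_char k (\<Sum>r=1..D. \<gamma> r * z ^ r)) \<le> \<epsilon> * real (CARD('p) ^ k)"
  shows "(norm (\<Sum>z\<in>galois_field k. field_char k (\<Sum>r=1..Suc D. \<beta> r * z ^ r)))\<^sup>2 \<le>
    real ((Suc D)\<^sup>2) * real (CARD('p) ^ k) + \<epsilon> * (real (CARD('p) ^ k))\<^sup>2"
proof -
  let ?F = "galois_field k :: 'p mod_ring alg_closure set" and ?q = "real (CARD('p) ^ k)"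
  define d where "d = (\<lambda>h j. poly (diff_poly D \<beta> j) h)"
  define B where "B = {h \<in> ?F. \<forall>r\<in>{1..D}. reduced_coeff k D (d h) r = 0}"
  have card_B: "card B \<le> (Suc D)\<^sup>2"
    unfolding B_def d_def by (rule card_degenerate_shifts[of k D \<beta>, OF k D mem top])
  have finF: "finite ?F" by (rule finite_galois_field[OF k])
  have cardF: "card ?F = CARD('p) ^ k" by (rule card_galois_field[OF k])
  have mem_d: "d h j \<in> ?F" if "h \<in> ?F" for h j
    unfolding d_def poly_diff_poly using mem that by (auto intro!: galois_field_intros)
  have triv: "norm (\<Sum>z\<in>?F. field_char k (f z)) \<le> ?q" for f
    using norm_sum[of "\<lambda>z. field_char k (f z)" ?F] by (simp add: cardF)
  let ?f = "\<lambda>z. \<Sum>r=1..Suc D. \<beta> r * z ^ r"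
  let ?I = "\<lambda>h. norm (\<Sum>z\<in>?F. field_char k (?f (z + h) - ?f z))"
  have good: "?I h \<le> \<epsilon> * ?q" if h: "h \<in> ?F - B" for h
  proof -
    have "field_char k (?f (z + h) - ?f z) =
        field_char k (d h 0) * field_char k (\<Sum>r=1..D. reduced_coeff k D (d h) r * z ^ r)"
      if z: "z \<in> ?F" for z
    proof -
      have "field_char k (?f (z + h) - ?f z) = field_char k (d h 0 + (\<Sum>j=1..D. d h j * z ^ j))"
        by (simp only: sum_powers_shift d_def)
      also have "\<dots> = field_char k (d h 0) * field_char k (\<Sum>j=1..D. d h j * z ^ j)"
        using h z mem_d by (intro field_char_add) (auto intro!: galois_field_intros)
      also have "field_char k (\<Sum>j=1..D. d h j * z ^ j) =
          field_char k (\<Sum>r=1..D. reduced_coeff k D (d h) r * z ^ r)"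
        using h z mem_d by (intro field_char_reduce[OF k]) (auto simp: d_def diff_poly_eq_0)
      finally show ?thesis .
    qed
    then have "(\<Sum>z\<in>?F. field_char k (?f (z + h) - ?f z)) =
        field_char k (d h 0) * (\<Sum>z\<in>?F. field_char k (\<Sum>r=1..D. reduced_coeff k D (d h) r * z ^ r))"
      unfolding sum_distrib_left by (rule sum.cong[OF refl])
    then have "?I h = norm (field_char k (d h 0) * (\<Sum>z\<in>?F. field_char k (\<Sum>r=1..D. reduced_coeff k D (d h) r * z ^ r)))"
      by (rule arg_cong)
    also have "\<dots> = norm (\<Sum>z\<in>?F. field_char k (\<Sum>r=1..D. reduced_coeff k D (d h) r * z ^ r))"
      by (simp add: norm_mult)
    also have "\<dots> \<le> \<epsilon> * ?q"
      using h mem_d by (intro IH reduced_coeff_mem) (auto simp: B_def reduced_coeff_def)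
    finally show ?thesis .
  qed
  have "(norm (\<Sum>z\<in>?F. field_char k (?f z)))\<^sup>2 \<le> (\<Sum>h\<in>?F. ?I h)"
    by (rule van_der_corput_field[OF k]) (intro galois_field_sum galois_field_mult galois_field_power mem)
  also have "\<dots> = (\<Sum>h\<in>?F - B. ?I h) + (\<Sum>h\<in>B. ?I h)"
    by (rule sum.subset_diff) (auto simp: B_def finF)
  also have "\<dots> \<le> real (card (?F - B)) * (\<epsilon> * ?q) + real (card B) * ?q"
    by (intro add_mono sum_bounded_above good triv) auto
  also have "\<dots> \<le> ?q * (\<epsilon> * ?q) + real ((Suc D)\<^sup>2) * ?q"
  proof (intro add_mono mult_right_mono)
    have "card (?F - B) \<le> card ?F" by (intro card_mono finF) auto
    then show "real (card (?F - B)) \<le> ?q" unfolding cardF by (simp only: of_nat_le_iff)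
    show "real (card B) \<le> real ((Suc D)\<^sup>2)" using card_B by (simp only: of_nat_le_iff)
  qed (use \<epsilon> in auto)
  also have "\<dots> = real ((Suc D)\<^sup>2) * ?q + \<epsilon> * ?q\<^sup>2"
    by (simp only: power2_eq_square mult_ac add_ac)
  finally show ?thesis .
qed

section \<open>Uniform bounds for Weyl sums\<close>

lemma card_power_gt: "real k < real (CARD('p::prime_card) ^ k)"
  unfolding of_nat_less_iff using CARD_prime_gt_1[where 'p='p] by (intro power_gt_expt) simp

lemma weyl_sum_bound:
  assumes "\<epsilon> > 0"
  shows "\<exists>K\<ge>1. \<forall>k\<ge>K. \<forall>\<beta> :: nat \<Rightarrow> 'p::prime_card mod_ring alg_closure.
    (\<forall>r. \<beta> r \<in> galois_field k) \<longrightarrow> (\<forall>r. CARD('p) dvd r \<longrightarrow> \<beta> r = 0) \<longrightarrow> (\<exists>r\<in>{1..D}. \<beta> r \<noteq> 0) \<longrightarrow>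
    norm (\<Sum>z\<in>galois_field k. field_char k (\<Sum>r=1..D. \<beta> r * z ^ r)) \<le> \<epsilon> * real (CARD('p) ^ k)"
  using assms
proof (induction D arbitrary: \<epsilon>)
  case 0
  show ?case by (intro exI[of _ 1]) auto
next
  case (Suc D)
  let ?W = "\<lambda>\<epsilon> k. \<forall>\<beta> :: nat \<Rightarrow> 'p mod_ring alg_closure.
    (\<forall>r. \<beta> r \<in> galois_field k) \<longrightarrow> (\<forall>r. CARD('p) dvd r \<longrightarrow> \<beta> r = 0) \<longrightarrow> (\<exists>r\<in>{1..D}. \<beta> r \<noteq> 0) \<longrightarrow>
    norm (\<Sum>z\<in>galois_field k. field_char k (\<Sum>r=1..D. \<beta> r * z ^ r)) \<le> \<epsilon> * real (CARD('p) ^ k)"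
  \<comment> \<open>Two instances of the hypothesis are used: \<epsilon> squared over 2 for the
    differenced sums, and \<epsilon> itself when the coefficient at D + 1 is 0, as it must be if p
    divides D + 1.\<close>
  have "\<epsilon>\<^sup>2 / 2 > 0" using Suc.prems by simp
  from Suc.IH[OF this] obtain K1 where K1: "K1 \<ge> 1" "\<forall>k\<ge>K1. ?W (\<epsilon>\<^sup>2 / 2) k" by blast
  from Suc.IH[OF Suc.prems] obtain K2 where K2: "K2 \<ge> 1" "\<forall>k\<ge>K2. ?W \<epsilon> k" by blast
  \<comment> \<open>Because \<open>p^k > k\<close>, this makes the exceptional shifts cost at most
    the other half of \<epsilon> squared.\<close>
  define K3 where "K3 = nat \<lceil>2 * real ((Suc D)\<^sup>2) / \<epsilon>\<^sup>2\<rceil>"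
  show ?case
  proof (intro exI[of _ "max (max K1 K2) K3"] conjI allI impI)
    fix k and \<beta> :: "nat \<Rightarrow> 'p mod_ring alg_closure"
    let ?q = "real (CARD('p) ^ k)"
    assume kK: "k \<ge> max (max K1 K2) K3" and mem: "\<forall>r. \<beta> r \<in> galois_field k"
      and red: "\<forall>r. CARD('p) dvd r \<longrightarrow> \<beta> r = 0" and nz: "\<exists>r\<in>{1..Suc D}. \<beta> r \<noteq> 0"
    have k: "k > 0" using kK K1(1) by simp
    have W1: "?W (\<epsilon>\<^sup>2 / 2) k" and W2: "?W \<epsilon> k" using K1(2) K2(2) kK by auto
    show "norm (\<Sum>z\<in>galois_field k. field_char k (\<Sum>r=1..Suc D. \<beta> r * z ^ r)) \<le> \<epsilon> * ?q"
    proof (cases "\<beta> (Suc D) = 0")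
      case True
      then have "\<exists>r\<in>{1..D}. \<beta> r \<noteq> 0" using nz by (metis atLeastAtMost_iff le_Suc_eq)
      then have "norm (\<Sum>z\<in>galois_field k. field_char k (\<Sum>r=1..D. \<beta> r * z ^ r)) \<le> \<epsilon> * ?q"
        using W2 mem red by blast
      then show ?thesis using True by simp
    next
      case top: False
      then have p: "\<not> CARD('p) dvd Suc D" using red by blast
      show ?thesis
      proof (cases "D = 0")
        case True
        then show ?thesis using field_char_sum[OF k, of "\<beta> 1"] mem top Suc.prems by simp
      next
        case False
        have "(norm (\<Sum>z\<in>galois_field k. field_char k (\<Sum>r=1..Suc D. \<beta> r * z ^ r)))\<^sup>2 \<le>
            real ((Suc D)\<^sup>2) * ?q + \<epsilon>\<^sup>2 / 2 * ?q\<^sup>2"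
        proof (rule weyl_sum_step[where \<beta> = \<beta>, OF k _ _ top p])
          show "norm (\<Sum>z\<in>galois_field k. field_char k (\<Sum>r=1..D. \<gamma> r * z ^ r)) \<le> \<epsilon>\<^sup>2 / 2 * ?q"
            if "\<And>r. \<gamma> r \<in> galois_field k" "\<And>r. CARD('p) dvd r \<Longrightarrow> \<gamma> r = 0" "\<exists>r\<in>{1..D}. \<gamma> r \<noteq> 0"
            for \<gamma> :: "nat \<Rightarrow> 'p mod_ring alg_closure"
            using W1 that by blast
        qed (use False mem in auto)
        also have "real ((Suc D)\<^sup>2) \<le> \<epsilon>\<^sup>2 / 2 * ?q"
        proof -
          have "2 * real ((Suc D)\<^sup>2) / \<epsilon>\<^sup>2 \<le> real k"
            using kK unfolding K3_def by linarith
          also have "\<dots> \<le> ?q" using card_power_gt[where 'p='p and k=k] by linarith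
          finally show ?thesis using Suc.prems by (simp add: field_simps)
        qed
        then have "real ((Suc D)\<^sup>2) * ?q + \<epsilon>\<^sup>2 / 2 * ?q\<^sup>2 \<le> (\<epsilon>\<^sup>2 / 2 * ?q) * ?q + \<epsilon>\<^sup>2 / 2 * ?q\<^sup>2"
          by (intro add_mono mult_right_mono) auto
        also have "\<dots> = (\<epsilon> * ?q)\<^sup>2" by (simp add: power2_eq_square algebra_simps)
        finally show ?thesis by (rule power2_le_imp_le) (use Suc.prems in simp)
      qed
    qed
  qed (use K1(1) in simp)
qed

lemma good_exponential_sum_bound:
  fixes Q :: "'p::prime_card mod_ring poly"
  assumes good: "good_for_irrational_equidistribution (map_poly (\<lambda>c. [:c:]) Q)" and "\<epsilon> > 0"
  shows "\<exists>K\<ge>1. \<forall>k\<ge>K. \<forall>b\<in>galois_field k - {0}.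
    norm (\<Sum>z\<in>galois_field k. field_char k (b * poly (map_poly to_ac Q) z)) \<le> \<epsilon> * real (CARD('p) ^ k)"
proof -
  let ?D = "degree Q"
  obtain K where K: "K \<ge> 1" "\<forall>k\<ge>K. \<forall>\<beta> :: nat \<Rightarrow> 'p mod_ring alg_closure.
    (\<forall>r. \<beta> r \<in> galois_field k) \<longrightarrow> (\<forall>r. CARD('p) dvd r \<longrightarrow> \<beta> r = 0) \<longrightarrow> (\<exists>r\<in>{1..?D}. \<beta> r \<noteq> 0) \<longrightarrow>
    norm (\<Sum>z\<in>galois_field k. field_char k (\<Sum>r=1..?D. \<beta> r * z ^ r)) \<le> \<epsilon> * real (CARD('p) ^ k)"
    using weyl_sum_bound[OF assms(2), where D = ?D and 'p='p] by blast
  show ?thesis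
  proof (intro exI[of _ K] conjI allI impI ballI K(1))
    fix k and b :: "'p mod_ring alg_closure"
    assume "K \<le> k" and b': "b \<in> galois_field k - {0}"
    then have k: "k > 0" and b: "b \<in> galois_field k" "b \<noteq> 0" using K(1) by auto
    let ?F = "galois_field k :: 'p mod_ring alg_closure set"
    define d where "d = (\<lambda>m. b * to_ac (coeff Q m))"
    define \<beta> where "\<beta> = reduced_coeff k ?D d"
    have d: "d m \<in> ?F" for m unfolding d_def by (intro galois_field_mult b galois_field_to_ac)
    have \<beta>: "\<beta> r \<in> ?F" for r unfolding \<beta>_def by (intro reduced_coeff_mem d)
    have "\<exists>r\<in>{1..?D}. \<beta> r \<noteq> 0"
      unfolding \<beta>_def d_def by (rule good_imp_reduced_coeff_nonzero[OF good k b])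
    then have bound: "norm (\<Sum>z\<in>?F. field_char k (\<Sum>r=1..?D. \<beta> r * z ^ r)) \<le> \<epsilon> * real (CARD('p) ^ k)"
      using K(2) \<open>K \<le> k\<close> \<beta> by (auto simp: \<beta>_def reduced_coeff_def)
    have "field_char k (b * poly (map_poly to_ac Q) z) =
        field_char k (d 0) * field_char k (\<Sum>r=1..?D. \<beta> r * z ^ r)" if z: "z \<in> ?F" for z
    proof -
      have "b * poly (map_poly to_ac Q) z = (\<Sum>m\<in>{..?D}. d m * z ^ m)"
        by (simp add: poly_altdef degree_map_poly coeff_map_poly d_def sum_distrib_left mult.assoc)
      also have "{..?D} = insert 0 {1..?D}" by auto
      finally have "b * poly (map_poly to_ac Q) z = d 0 + (\<Sum>m=1..?D. d m * z ^ m)" by simp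
      moreover have "field_char k (d 0 + (\<Sum>m=1..?D. d m * z ^ m)) =
          field_char k (d 0) * field_char k (\<Sum>m=1..?D. d m * z ^ m)"
        by (intro field_char_add galois_field_sum galois_field_mult galois_field_power d z)
      moreover have "field_char k (\<Sum>m=1..?D. d m * z ^ m) = field_char k (\<Sum>r=1..?D. \<beta> r * z ^ r)"
        unfolding \<beta>_def by (rule field_char_reduce[OF k d _ z]) (simp add: d_def coeff_eq_0)
      ultimately show ?thesis by simp
    qed
    then have "(\<Sum>z\<in>?F. field_char k (b * poly (map_poly to_ac Q) z)) =
        field_char k (d 0) * (\<Sum>z\<in>?F. field_char k (\<Sum>r=1..?D. \<beta> r * z ^ r))"
      unfolding sum_distrib_left by (rule sum.cong[OF refl])
    then show "norm (\<Sum>z\<in>?F. field_char k (b * poly (map_poly to_ac Q) z)) \<le> \<epsilon> * real (CARD('p) ^ k)"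
      using bound by (simp add: norm_mult)
  qed
qed

section \<open>Positive definite functions\<close>

text \<open>Nonnegative Fourier coefficients \<open>w\<close>, with \<open>a\<close> bounding the
  mean (frequency 0) from below and \<open>T\<close> bounding the total mass. The mean yields the
  main term of an average, the mass controls its error.\<close>

definition positive_definite ::
  "nat \<Rightarrow> real \<Rightarrow> real \<Rightarrow> ('p::prime_card mod_ring alg_closure \<Rightarrow> real) \<Rightarrow> bool" where
  "positive_definite k a T G \<longleftrightarrow> (\<exists>w. (\<forall>b\<in>galois_field k. 0 \<le> w b) \<and> a \<le> w 0 \<and>
     (\<Sum>b\<in>galois_field k. w b) \<le> T \<and>
     (\<forall>v\<in>galois_field k. of_real (G v) = (\<Sum>b\<in>galois_field k. of_real (w b) * field_char k (b * v))))"

lemma positive_definite_one: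
  assumes k: "k > 0"
  shows "positive_definite k 1 1 (\<lambda>_ :: 'p::prime_card mod_ring alg_closure. 1)"
  unfolding positive_definite_def
  by (rule exI[of _ "\<lambda>b. if b = 0 then 1 else 0"])
     (simp add: finite_galois_field[OF k] galois_field_zero if_distrib[of of_real]
       if_distrib[of "\<lambda>u. u * _"] cong: if_cong)

text \<open>The Fourier coefficients are convolved. Masses multiply, and frequency 0 receives at
  least \<open>s 0 * t 0\<close> because nothing negative is added.\<close>

lemma positive_definite_mult:
  fixes G H :: "'p::prime_card mod_ring alg_closure \<Rightarrow> real"
  assumes k: "k > 0" and G: "positive_definite k a S G" and H: "positive_definite k b T H"
    and nonneg: "0 \<le> a" "0 \<le> b"
  shows "positive_definite k (a * b) (S * T) (\<lambda>v. G v * H v)"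
proof -
  let ?F = "galois_field k :: 'p mod_ring alg_closure set"
  have fin: "finite ?F" by (rule finite_galois_field[OF k])
  obtain s where s: "\<And>c. c \<in> ?F \<Longrightarrow> 0 \<le> s c" "a \<le> s 0" "(\<Sum>c\<in>?F. s c) \<le> S"
    "\<And>v. v \<in> ?F \<Longrightarrow> of_real (G v) = (\<Sum>c\<in>?F. of_real (s c) * field_char k (c * v))"
    using G unfolding positive_definite_def by blast
  obtain t where t: "\<And>c. c \<in> ?F \<Longrightarrow> 0 \<le> t c" "b \<le> t 0" "(\<Sum>c\<in>?F. t c) \<le> T"
    "\<And>v. v \<in> ?F \<Longrightarrow> of_real (H v) = (\<Sum>c\<in>?F. of_real (t c) * field_char k (c * v))"
    using H unfolding positive_definite_def by blast
  define w where "w = (\<lambda>e. \<Sum>c\<in>?F. s c * t (e - c))"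
  have shift: "(\<Sum>e\<in>?F. f (e - c)) = (\<Sum>e\<in>?F. f e)" if "c \<in> ?F"
    for c and f :: "'p mod_ring alg_closure \<Rightarrow> 'b::comm_monoid_add"
    by (rule sum.reindex_bij_witness[of _ "\<lambda>e. e + c" "\<lambda>e. e - c"])
       (auto intro: galois_field_add galois_field_diff that)
  show ?thesis
    unfolding positive_definite_def
  proof (intro exI[of _ w] conjI ballI)
    fix e assume e: "e \<in> ?F"
    show "0 \<le> w e" unfolding w_def
      by (intro sum_nonneg mult_nonneg_nonneg s t galois_field_diff e)
  next
    have "a * b \<le> s 0 * t (0 - 0)" using s(2) t(2) nonneg by (intro mult_mono) auto
    also have "\<dots> \<le> w 0"
      unfolding w_def using fin s(1) t(1)
      by (intro member_le_sum) (auto intro!: mult_nonneg_nonneg galois_field_diff galois_field_minus galois_field_zero)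
    finally show "a * b \<le> w 0" .
  next
    have "(\<Sum>e\<in>?F. w e) = (\<Sum>c\<in>?F. s c * (\<Sum>e\<in>?F. t (e - c)))"
      unfolding w_def sum_distrib_left by (rule sum.swap)
    also have "\<dots> = (\<Sum>c\<in>?F. s c) * (\<Sum>e\<in>?F. t e)"
      by (simp add: shift sum_distrib_right)
    also have "\<dots> \<le> S * T"
      using s t by (intro mult_mono order.trans[OF sum_nonneg s(3)] sum_nonneg) auto
    finally show "(\<Sum>e\<in>?F. w e) \<le> S * T" .
  next
    fix v assume v: "v \<in> ?F"
    have "of_real (G v * H v) =
        (\<Sum>c\<in>?F. of_real (s c) * field_char k (c * v) * (\<Sum>e\<in>?F. of_real (t e) * field_char k (e * v)))"
      using s(4)[OF v] t(4)[OF v] by (simp add: sum_distrib_right)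
    also have "\<dots> = (\<Sum>c\<in>?F. \<Sum>e\<in>?F. of_real (s c * t (e - c)) * field_char k (e * v))"
    proof (rule sum.cong[OF refl])
      fix c assume c: "c \<in> ?F"
      have "of_real (s c) * field_char k (c * v) * (\<Sum>e\<in>?F. of_real (t e) * field_char k (e * v)) =
          (\<Sum>e\<in>?F. of_real (s c) * field_char k (c * v) * (of_real (t (e - c)) * field_char k ((e - c) * v)))"
        by (simp only: sum_distrib_left[symmetric] shift[OF c, of "\<lambda>e. of_real (t e) * field_char k (e * v)"])
      also have "\<dots> = (\<Sum>e\<in>?F. of_real (s c * t (e - c)) * field_char k (e * v))"
      proof (rule sum.cong[OF refl])
        fix e assume e: "e \<in> ?F"
        have "field_char k (e * v) = field_char k (c * v + (e - c) * v)"
          by (simp add: algebra_simps)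
        also have "\<dots> = field_char k (c * v) * field_char k ((e - c) * v)"
          by (intro field_char_add galois_field_mult galois_field_diff c e v)
        finally show "of_real (s c) * field_char k (c * v) * (of_real (t (e - c)) * field_char k ((e - c) * v)) =
            of_real (s c * t (e - c)) * field_char k (e * v)" by simp
      qed
      finally show "of_real (s c) * field_char k (c * v) * (\<Sum>e\<in>?F. of_real (t e) * field_char k (e * v)) =
        (\<Sum>e\<in>?F. of_real (s c * t (e - c)) * field_char k (e * v))" .
    qed
    also have "\<dots> = (\<Sum>e\<in>?F. \<Sum>c\<in>?F. of_real (s c * t (e - c)) * field_char k (e * v))"
      by (rule sum.swap)
    also have "\<dots> = (\<Sum>e\<in>?F. of_real (w e) * field_char k (e * v))"
      unfolding w_def of_real_sum sum_distrib_right ..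
    finally show "of_real (G v * H v) = (\<Sum>e\<in>?F. of_real (w e) * field_char k (e * v))" .
  qed
qed

lemma positive_definite_prod:
  fixes G :: "'i \<Rightarrow> 'p::prime_card mod_ring alg_closure \<Rightarrow> real"
  assumes k: "k > 0" and "finite S"
    and "\<And>i. i \<in> S \<Longrightarrow> positive_definite k (a i) T (G i)" "\<And>i. i \<in> S \<Longrightarrow> 0 \<le> a i"
  shows "positive_definite k (\<Prod>i\<in>S. a i) (T ^ card S) (\<lambda>v. \<Prod>i\<in>S. G i v)"
  using assms(2-4)
proof (induction S rule: finite_induct)
  case empty
  then show ?case using positive_definite_one[OF k, where 'p='p] by simp
next
  case (insert i S)
  then show ?case
    by (simp add: positive_definite_mult[OF k] prod_nonneg)
qed

text \<open>Frequency 0 contributes at least \<open>a\<close> per point; all others together at most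
  \<epsilon> times their mass.\<close>

lemma positive_definite_average:
  fixes G :: "'p::prime_card mod_ring alg_closure \<Rightarrow> real" and f :: "'p mod_ring alg_closure \<Rightarrow> 'p mod_ring alg_closure"
  assumes k: "k > 0" and G: "positive_definite k a T G" and \<epsilon>: "\<epsilon> \<ge> 0"
    and f: "\<And>z. z \<in> galois_field k \<Longrightarrow> f z \<in> galois_field k"
    and bound: "\<And>b. b \<in> galois_field k - {0} \<Longrightarrow>
      norm (\<Sum>z\<in>galois_field k. field_char k (b * f z)) \<le> \<epsilon> * real (CARD('p) ^ k)"
  shows "(\<Sum>z\<in>galois_field k. G (f z)) \<ge> real (CARD('p) ^ k) * (a - \<epsilon> * T)"
proof -
  let ?F = "galois_field k :: 'p mod_ring alg_closure set" and ?q = "real (CARD('p) ^ k)"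
  have fin: "finite ?F" by (rule finite_galois_field[OF k])
  obtain w where w: "\<And>b. b \<in> ?F \<Longrightarrow> 0 \<le> w b" "a \<le> w 0" "(\<Sum>b\<in>?F. w b) \<le> T"
    "\<And>v. v \<in> ?F \<Longrightarrow> of_real (G v) = (\<Sum>b\<in>?F. of_real (w b) * field_char k (b * v))"
    using G unfolding positive_definite_def by blast
  let ?E = "\<lambda>b. \<Sum>z\<in>?F. field_char k (b * f z)"
  have "of_real (\<Sum>z\<in>?F. G (f z)) = (\<Sum>z\<in>?F. \<Sum>b\<in>?F. of_real (w b) * field_char k (b * f z))"
    by (simp add: w(4) f)
  also have "\<dots> = (\<Sum>b\<in>?F. of_real (w b) * ?E b)"
    unfolding sum_distrib_left by (rule sum.swap)
  also have "\<dots> = of_real (w 0) * ?E 0 + (\<Sum>b\<in>?F - {0}. of_real (w b) * ?E b)"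
    by (rule sum.remove[OF fin galois_field_zero])
  also have "?E 0 = of_real ?q" by (simp add: card_galois_field[OF k])
  finally have eq: "of_real ((\<Sum>z\<in>?F. G (f z)) - w 0 * ?q) = (\<Sum>b\<in>?F - {0}. of_real (w b) * ?E b)"
    by simp
  have "\<bar>(\<Sum>z\<in>?F. G (f z)) - w 0 * ?q\<bar> = norm (of_real ((\<Sum>z\<in>?F. G (f z)) - w 0 * ?q) :: complex)"
    by (simp only: norm_of_real)
  also have "\<dots> \<le> (\<Sum>b\<in>?F - {0}. norm (of_real (w b) * ?E b))"
    unfolding eq by (rule norm_sum)
  also have "\<dots> \<le> (\<Sum>b\<in>?F - {0}. w b * (\<epsilon> * ?q))"
    unfolding norm_mult using w(1) bound by (intro sum_mono mult_mono) auto
  also have "\<dots> \<le> (\<Sum>b\<in>?F. w b) * (\<epsilon> * ?q)"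
    unfolding sum_distrib_right using fin w(1) \<epsilon> by (intro sum_mono2) auto
  also have "\<dots> \<le> T * (\<epsilon> * ?q)" using w(3) \<epsilon> by (intro mult_right_mono) auto
  finally have "(\<Sum>z\<in>?F. G (f z)) \<ge> w 0 * ?q - T * (\<epsilon> * ?q)" by linarith
  moreover have "a * ?q \<le> w 0 * ?q" using w(2) by (intro mult_right_mono) auto
  ultimately have "a * ?q - T * (\<epsilon> * ?q) \<le> (\<Sum>z\<in>?F. G (f z))" by linarith
  then show ?thesis by (simp add: algebra_simps)
qed

section \<open>Counting differences of values on a set\<close>

lemma card_difference_le:
  fixes f :: "'p::prime_card mod_ring alg_closure \<Rightarrow> 'p mod_ring alg_closure"
  assumes k: "k > 0" and A: "A \<subseteq> galois_field k"
    and fib: "\<And>u. card {x \<in> galois_field k. f x = u} \<le> D"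
  shows "card {(x, y) \<in> A \<times> A. f x - f y = v} \<le> D * CARD('p) ^ k"
proof -
  let ?F = "galois_field k :: 'p mod_ring alg_closure set"
  have fin: "finite ?F" by (rule finite_galois_field[OF k])
  have "card {(x, y) \<in> A \<times> A. f x - f y = v} \<le> card (\<Union>y\<in>?F. (\<lambda>x. (x, y)) ` {x \<in> ?F. f x = v + f y})"
    using fin A by (intro card_mono) (auto simp: algebra_simps)
  also have "\<dots> \<le> (\<Sum>y\<in>?F. card ((\<lambda>x. (x, y)) ` {x \<in> ?F. f x = v + f y}))"
    by (rule card_UN_le[OF fin])
  also have "\<dots> \<le> (\<Sum>y\<in>?F. D)"
    by (intro sum_mono order.trans[OF card_image_le] fib) (use fin in auto)
  also have "\<dots> = D * CARD('p) ^ k" by (simp add: card_galois_field[OF k])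
  finally show ?thesis .
qed

text \<open>The Fourier coefficients are squared moduli of normalized character sums over A, so the
  one at 0 is the squared density. Their total is the value at v = 0, the number of pairs with f x =
  f y divided by \<open>p^k\<close>, which the fiber bound keeps below D.\<close>

lemma positive_definite_differences:
  fixes f :: "'p::prime_card mod_ring alg_closure \<Rightarrow> 'p mod_ring alg_closure"
  assumes k: "k > 0" and A: "A \<subseteq> galois_field k"
    and f: "\<And>z. z \<in> galois_field k \<Longrightarrow> f z \<in> galois_field k"
    and fib: "\<And>u. card {x \<in> galois_field k. f x = u} \<le> D"
  shows "positive_definite k ((real (card A) / real (CARD('p) ^ k))\<^sup>2) (real D)
    (\<lambda>v. real (card {(x, y) \<in> A \<times> A. f x - f y = v}) / real (CARD('p) ^ k))"
proof -
  let ?F = "galois_field k :: 'p mod_ring alg_closure set" and ?q = "real (CARD('p) ^ k)"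
  let ?N = "\<lambda>v. real (card {(x, y) \<in> A \<times> A. f x - f y = v}) / ?q"
  have fin: "finite ?F" by (rule finite_galois_field[OF k])
  have finA: "finite A" using finite_subset[OF A fin] .
  have q0: "?q > 0" using CARD_prime_pos[where 'p='p] by simp
  define w where "w = (\<lambda>b. (norm (\<Sum>x\<in>A. field_char k (b * f x)))\<^sup>2 / ?q\<^sup>2)"
  have fA: "x \<in> A \<Longrightarrow> f x \<in> ?F" for x using A f by blast
  have expand: "of_real (?N v) = (\<Sum>b\<in>?F. of_real (w b) * field_char k (b * v))" if v: "v \<in> ?F" for v
  proof -
    have "{(x, y) \<in> A \<times> A. f x - f y = v} = {u \<in> A \<times> A. f (fst u) - f (snd u) = v}" by auto
    then have "card {(x, y) \<in> A \<times> A. f x - f y = v} = (\<Sum>(x, y)\<in>A \<times> A. if f x - f y = v then 1 else 0)"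
      using finA by (simp add: card_eq_sum sum.inter_filter case_prod_beta del: sum_constant One_nat_def)
    then have "of_real (?N v) = (\<Sum>(x, y)\<in>A \<times> A. (if f x - f y = v then 1 else 0)) / (of_real ?q :: complex)"
      by (simp add: if_distrib case_prod_beta cong: if_cong)
    \<comment> \<open>Orthogonality detects f x - f y = v by averaging the characters over all
      b.\<close>
    also have "(\<Sum>(x, y)\<in>A \<times> A. (if f x - f y = v then 1 else 0) :: complex) =
        (\<Sum>(x, y)\<in>A \<times> A. (\<Sum>b\<in>?F. field_char k (b * v) * (cnj (field_char k (b * f x)) * field_char k (b * f y))) / of_real ?q)"
    proof (rule sum.cong[OF refl], clarify)
      fix x y assume xy: "x \<in> A" "y \<in> A"
      have "(\<Sum>b\<in>?F. field_char k (b * v) * (cnj (field_char k (b * f x)) * field_char k (b * f y))) =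
          (\<Sum>b\<in>?F. field_char k ((v - (f x - f y)) * b))"
      proof (rule sum.cong[OF refl])
        fix b assume b: "b \<in> ?F"
        have "(v - (f x - f y)) * b = (b * v - b * f x) + b * f y" by (simp add: algebra_simps)
        then show "field_char k (b * v) * (cnj (field_char k (b * f x)) * field_char k (b * f y)) =
            field_char k ((v - (f x - f y)) * b)"
          using b v xy fA by (simp add: field_char_add field_char_diff galois_field_mult galois_field_diff)
      qed
      also have "\<dots> = (if v - (f x - f y) = 0 then of_nat (CARD('p) ^ k) else 0)"
        using v xy fA by (intro field_char_sum k galois_field_diff) auto
      finally show "(if f x - f y = v then 1 else 0) =
          (\<Sum>b\<in>?F. field_char k (b * v) * (cnj (field_char k (b * f x)) * field_char k (b * f y))) / of_real ?q"
        using q0 by auto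
    qed
    also have "\<dots> / of_real ?q = (\<Sum>b\<in>?F. \<Sum>(x, y)\<in>A \<times> A.
        field_char k (b * v) * (cnj (field_char k (b * f x)) * field_char k (b * f y)) / (of_real ?q)\<^sup>2)"
      by (subst sum.swap) (simp add: sum_divide_distrib case_prod_beta power2_eq_square)
    also have "\<dots> = (\<Sum>b\<in>?F. of_real (w b) * field_char k (b * v))"
    proof (rule sum.cong[OF refl])
      fix b
      have "(\<Sum>(x, y)\<in>A \<times> A. cnj (field_char k (b * f x)) * field_char k (b * f y)) =
          cnj (\<Sum>x\<in>A. field_char k (b * f x)) * (\<Sum>y\<in>A. field_char k (b * f y))"
        by (simp add: sum_product sum.cartesian_product)
      also have "\<dots> = of_real ((norm (\<Sum>x\<in>A. field_char k (b * f x)))\<^sup>2)"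
        by (simp only: complex_norm_square mult.commute)
      finally have sq: "(\<Sum>(x, y)\<in>A \<times> A. cnj (field_char k (b * f x)) * field_char k (b * f y)) =
          of_real ((norm (\<Sum>x\<in>A. field_char k (b * f x)))\<^sup>2)" .
      have "(\<Sum>(x, y)\<in>A \<times> A. field_char k (b * v) * (cnj (field_char k (b * f x)) * field_char k (b * f y)) / (of_real ?q)\<^sup>2) =
          field_char k (b * v) * (\<Sum>(x, y)\<in>A \<times> A. cnj (field_char k (b * f x)) * field_char k (b * f y)) / (of_real ?q)\<^sup>2"
        by (simp add: sum_distrib_left sum_divide_distrib case_prod_beta)
      then show "(\<Sum>(x, y)\<in>A \<times> A. field_char k (b * v) * (cnj (field_char k (b * f x)) * field_char k (b * f y)) / (of_real ?q)\<^sup>2) =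
          of_real (w b) * field_char k (b * v)"
        unfolding sq w_def by simp
    qed
    finally show ?thesis .
  qed
  show ?thesis
    unfolding positive_definite_def
  proof (intro exI[of _ w] conjI ballI)
    show "0 \<le> w b" for b by (simp add: w_def)
    show "(real (card A) / ?q)\<^sup>2 \<le> w 0" by (simp add: w_def power_divide)
    have "complex_of_real (\<Sum>b\<in>?F. w b) = of_real (?N 0)"
      using expand[OF galois_field_zero] by simp
    then have "(\<Sum>b\<in>?F. w b) = ?N 0" by (simp only: of_real_eq_iff)
    also have "\<dots> \<le> real D"
    proof -
      have "real (card {(x, y) \<in> A \<times> A. f x - f y = 0}) \<le> real D * ?q"
        using card_difference_le[OF k A fib, of 0] by (simp only: of_nat_le_iff flip: of_nat_mult)
      then show ?thesis using q0 by (simp add: divide_le_eq)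
    qed
    finally show "(\<Sum>b\<in>?F. w b) \<le> real D" .
  qed (rule expand)
qed

section \<open>The coloring argument\<close>

text \<open>If s colors have density at least the threshold t of index s, the mean of their product
  is at least \<open>t^(2*s) >= t^(2*r)\<close>. At most r colors below the next threshold, with the
  product bounded by \<open>D^r\<close>, then absorb at most a third of
  \<open>t^(2*r)\<close>.\<close>

fun color_threshold :: "nat \<Rightarrow> real \<Rightarrow> nat \<Rightarrow> real" where
  "color_threshold r D 0 = 1"
| "color_threshold r D (Suc s) = color_threshold r D s ^ (2 * r) / (3 * real r * D ^ r)"

lemma color_threshold_bounds:
  assumes "r > 0" "D \<ge> 1"
  shows "0 < color_threshold r D s \<and> color_threshold r D s \<le> 1"
proof (induction s)
  case (Suc s)
  have "1 * 1 \<le> (3 * real r) * D ^ r" using assms by (intro mult_mono) auto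
  moreover have "color_threshold r D s ^ (2 * r) \<le> 1" using Suc by (intro power_le_one) auto
  ultimately have "color_threshold r D s ^ (2 * r) \<le> 3 * real r * D ^ r" by linarith
  with Suc assms show ?case by (simp add: divide_le_eq)
qed simp

text \<open>Enlarging a family of colors raises the index; as the threshold then falls, the old
  members stay admissible.\<close>

lemma color_threshold_antimono:
  assumes "r > 0" "D \<ge> 1" "s \<le> s'"
  shows "color_threshold r D s' \<le> color_threshold r D s"
proof -
  have "color_threshold r D (Suc s) \<le> color_threshold r D s" for s
  proof -
    let ?t = "color_threshold r D s"
    have t: "0 < ?t" "?t \<le> 1" using color_threshold_bounds[OF assms(1,2)] by auto
    have "1 * 1 \<le> (3 * real r) * D ^ r" using assms by (intro mult_mono) auto
    then have "?t ^ (2 * r) / (3 * real r * D ^ r) \<le> ?t ^ (2 * r) / 1"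
      using t by (intro divide_left_mono) auto
    also have "\<dots> \<le> ?t" using power_decreasing[of 1 "2 * r" ?t] t assms(1) by simp
    finally show ?thesis by simp
  qed
  from lift_Suc_antimono_le[of "color_threshold r D", OF this assms(3)] show ?thesis .
qed

text \<open>Only an inequality, because color classes may overlap.\<close>

lemma sum_UN_le:
  fixes f :: "'a \<Rightarrow> real"
  assumes "finite I" "\<And>i. i \<in> I \<Longrightarrow> finite (A i)" "\<And>x. 0 \<le> f x"
  shows "(\<Sum>x\<in>(\<Union>i\<in>I. A i). f x) \<le> (\<Sum>i\<in>I. \<Sum>x\<in>A i. f x)"
  using assms
proof (induction I rule: finite_induct)
  case (insert i I)
  let ?U = "\<Union>i\<in>I. A i"
  have "sum f (A i \<union> ?U) = sum f (A i) + sum f ?U - sum f (A i \<inter> ?U)"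
    using insert by (intro sum_Un) auto
  moreover have "0 \<le> sum f (A i \<inter> ?U)" using insert by (intro sum_nonneg) auto
  ultimately show ?case using insert by simp
qed simp

text \<open>Keep a maximal family of colors of density at least the threshold indexed by its size. The next
  threshold is so small that the remaining colors cannot absorb the common return times of the
  family, so some return time of a kept color has that color.\<close>

lemma monochromatic_return:
  fixes N :: "nat \<Rightarrow> 'a \<Rightarrow> real" and C :: "nat \<Rightarrow> 'a set" and r :: nat and D :: real
  defines "\<tau> \<equiv> color_threshold r D"
  assumes r: "r > 0" and D: "D \<ge> 1" and fin: "finite F" "F \<noteq> {}" and F: "F = (\<Union>i\<in>{1..r}. C i)"
    and N: "\<And>i z. 0 \<le> N i z" "\<And>i z. N i z \<le> D"
    and avg: "\<And>S. S \<subseteq> {1..r} \<Longrightarrow>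
      (\<Sum>z\<in>F. \<Prod>i\<in>S. N i z) \<ge> real (card F) * ((\<Prod>i\<in>S. (real (card (C i)) / real (card F))\<^sup>2) - \<tau> r ^ (2 * r) / 3)"
  shows "\<exists>i\<in>{1..r}. (\<Sum>z\<in>C i. N i z) \<ge> real (card F) * (\<tau> r ^ (2 * r) / (4 * real r * D ^ r))"
proof (rule ccontr)
  assume neg: "\<not> ?thesis"
  define q where "q = real (card F)"
  have q: "q > 0" using fin by (simp add: q_def card_gt_0_iff)
  have \<tau>: "0 < \<tau> s" "\<tau> s \<le> 1" for s using color_threshold_bounds[OF r D] by (auto simp: \<tau>_def)
  have anti: "s \<le> s' \<Longrightarrow> \<tau> s' \<le> \<tau> s" for s s'
    unfolding \<tau>_def by (rule color_threshold_antimono[OF r D])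
  have Dr: "D ^ s \<le> D ^ r" if "s \<le> r" for s using D that by (intro power_increasing) auto
  have finC: "finite (C i)" if "i \<in> {1..r}" for i using fin F that by (metis UN_upper finite_subset)
  let ?good = "\<lambda>S. S \<subseteq> {1..r} \<and> (\<forall>i\<in>S. real (card (C i)) \<ge> \<tau> (card S) * q)"
  have "finite {S. ?good S}" by (rule finite_subset[of _ "Pow {1..r}"]) auto
  moreover have "{} \<in> {S. ?good S}" by simp
  ultimately obtain S where "S \<in> {S. ?good S}" and max': "\<forall>S'\<in>{S. ?good S}. S \<subseteq> S' \<longrightarrow> S = S'"
    using finite_has_maximal[of "{S. ?good S}"] by (metis (no_types, lifting) empty_iff)
  then have S: "?good S" by simp
  have max: "S = S'" if "?good S'" "S \<subseteq> S'" for S' using max' that by simp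
  define s where "s = card S"
  have finS: "finite S" using S finite_subset by blast
  have sr: "s \<le> r" unfolding s_def using S card_mono[of "{1..r}" S] by simp
  define \<eta> where "\<eta> = \<tau> s ^ (2 * r)"
  define U where "U = (\<Union>i\<in>S. C i)"
  have U: "U \<subseteq> F" using S by (auto simp: U_def F)
  \<comment> \<open>Otherwise adding color \<open>i\<close> would give an admissible family of size
    s + 1.\<close>
  have small: "real (card (C i)) \<le> \<tau> (Suc s) * q" if i: "i \<in> {1..r} - S" for i
  proof (rule ccontr)
    assume *: "\<not> real (card (C i)) \<le> \<tau> (Suc s) * q"
    have card: "card (insert i S) = Suc s" using i finS by (simp add: s_def)
    have "\<tau> (Suc s) * q \<le> \<tau> s * q" using q by (intro mult_right_mono anti) auto
    then have "\<tau> (Suc s) * q \<le> real (card (C j))" if "j \<in> insert i S" for j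
      using S * that unfolding s_def by force
    then have "?good (insert i S)" unfolding card using S i by simp
    from max[OF this] i show False by blast
  qed
  have nonneg: "0 \<le> (\<Prod>i\<in>S. N i z)" for z by (intro prod_nonneg) (use N in auto)
  have le_Dr: "(\<Prod>i\<in>S'. N i z) \<le> D ^ r" if "S' \<subseteq> S" for S' z
  proof -
    have "(\<Prod>i\<in>S'. N i z) \<le> (\<Prod>i\<in>S'. D)" using N by (intro prod_mono) auto
    also have "\<dots> = D ^ card S'" by simp
    also have "\<dots> \<le> D ^ r" using that sr card_mono[OF finS that] by (intro Dr) (auto simp: s_def)
    finally show ?thesis .
  qed
  have "\<eta> \<le> (\<Prod>i\<in>S. (real (card (C i)) / q)\<^sup>2)"
  proof -
    have "\<eta> \<le> \<tau> s ^ (2 * s)"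
      unfolding \<eta>_def using \<tau>[of s] sr by (intro power_decreasing) auto
    also have "\<dots> = (\<Prod>i\<in>S. (\<tau> s)\<^sup>2)" by (simp add: s_def power_mult)
    also have "\<dots> \<le> (\<Prod>i\<in>S. (real (card (C i)) / q)\<^sup>2)"
      using S q \<tau>[of s] by (intro prod_mono conjI power_mono) (auto simp: s_def le_divide_eq)
    finally show ?thesis .
  qed
  moreover have "\<tau> r ^ (2 * r) \<le> \<eta>"
    unfolding \<eta>_def using \<tau>[of r] by (intro power_mono anti sr) auto
  \<comment> \<open>The main term is at least 2/3 of \<open>q * \<eta>\<close>; the two pieces
    bounded below amount to at most 1/3 + 1/4, which is less.\<close>
  ultimately have "q * (\<eta> - \<eta> / 3) \<le> q * ((\<Prod>i\<in>S. (real (card (C i)) / q)\<^sup>2) - \<tau> r ^ (2 * r) / 3)"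
    using q by (intro mult_left_mono) auto
  also have "\<dots> \<le> (\<Sum>z\<in>F. \<Prod>i\<in>S. N i z)"
    unfolding q_def using S by (intro avg) auto
  also have "\<dots> = (\<Sum>z\<in>F - U. \<Prod>i\<in>S. N i z) + (\<Sum>z\<in>U. \<Prod>i\<in>S. N i z)"
    by (rule sum.subset_diff[OF U fin(1)])
  also have "(\<Sum>z\<in>F - U. \<Prod>i\<in>S. N i z) \<le> q * (\<eta> / 3)"
  proof -
    have "card (F - U) \<le> card (\<Union>i\<in>{1..r} - S. C i)"
      using finC by (intro card_mono) (auto simp: F U_def)
    also have "\<dots> \<le> (\<Sum>i\<in>{1..r} - S. card (C i))" by (rule card_UN_le) simp
    finally have "real (card (F - U)) \<le> (\<Sum>i\<in>{1..r} - S. real (card (C i)))"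
      by (simp only: of_nat_sum[symmetric] of_nat_le_iff)
    also have "\<dots> \<le> real (card ({1..r} - S)) * (\<tau> (Suc s) * q)"
      by (intro sum_bounded_above small)
    also have "\<dots> \<le> real r * (\<tau> (Suc s) * q)"
      using q \<tau>[of "Suc s"] card_mono[of "{1..r}" "{1..r} - S"] by (intro mult_right_mono) auto
    finally have c: "real (card (F - U)) \<le> real r * (\<tau> (Suc s) * q)" .
    have "(\<Sum>z\<in>F - U. \<Prod>i\<in>S. N i z) \<le> real (card (F - U)) * D ^ r"
      by (intro sum_bounded_above le_Dr) auto
    also have "\<dots> \<le> real r * (\<tau> (Suc s) * q) * D ^ r"
      using c D by (intro mult_right_mono) auto
    also have "\<dots> = q * (\<eta> / 3)" using r D by (simp add: \<tau>_def \<eta>_def)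
    finally show ?thesis .
  qed
  also have "(\<Sum>z\<in>U. \<Prod>i\<in>S. N i z) \<le> q * (\<eta> / 4)"
  proof -
    have "(\<Sum>z\<in>U. \<Prod>i\<in>S. N i z) \<le> (\<Sum>i\<in>S. \<Sum>z\<in>C i. \<Prod>j\<in>S. N j z)"
      unfolding U_def using S nonneg finC finS by (intro sum_UN_le) auto
    also have "\<dots> \<le> (\<Sum>i\<in>S. q * (\<tau> r ^ (2 * r) / (4 * real r)))"
    proof (rule sum_mono)
      fix i assume i: "i \<in> S"
      \<comment> \<open>Only the factor of color \<open>i\<close> itself is kept on
        \<open>C i\<close>; the others cost \<open>D^r\<close>, which the negated conclusion has in
        its denominator.\<close>
      have "(\<Prod>j\<in>S. N j z) \<le> N i z * D ^ r" for z
        using N le_Dr[of "S - {i}" z] i finS by (simp add: prod.remove mult_left_mono)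
      then have "(\<Sum>z\<in>C i. \<Prod>j\<in>S. N j z) \<le> (\<Sum>z\<in>C i. N i z) * D ^ r"
        by (simp add: sum_distrib_right sum_mono)
      also have "\<dots> \<le> (q * (\<tau> r ^ (2 * r) / (4 * real r * D ^ r))) * D ^ r"
      proof (rule mult_right_mono)
        have "i \<in> {1..r}" using S i by blast
        then show "(\<Sum>z\<in>C i. N i z) \<le> q * (\<tau> r ^ (2 * r) / (4 * real r * D ^ r))"
          using neg unfolding q_def by (meson linear)
      qed (use D in simp)
      also have "\<dots> = q * (\<tau> r ^ (2 * r) / (4 * real r))" using D by simp
      finally show "(\<Sum>z\<in>C i. \<Prod>j\<in>S. N j z) \<le> q * (\<tau> r ^ (2 * r) / (4 * real r))" .
    qed
    also have "\<dots> = real s * (q * (\<tau> r ^ (2 * r) / (4 * real r)))" by (simp add: s_def)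
    also have "\<dots> \<le> real r * (q * (\<tau> r ^ (2 * r) / (4 * real r)))"
      using q \<tau>[of r] sr by (intro mult_right_mono) auto
    also have "\<dots> = q * (\<tau> r ^ (2 * r) / 4)" using r by simp
    also have "\<dots> \<le> q * (\<eta> / 4)" using q \<open>\<tau> r ^ (2 * r) \<le> \<eta>\<close> by simp
    finally show ?thesis .
  qed
  finally have "q * \<eta> \<le> 0" by (simp add: algebra_simps)
  moreover have "q * \<eta> > 0" using q \<tau>[of s] by (simp add: \<eta>_def)
  ultimately show False by linarith
qed

section \<open>Combination for the polynomials P and Q\<close>

lemma card_poly_fiber:
  fixes P :: "'a::idom poly"
  assumes "degree P > 0"
  shows "card {x \<in> A. poly P x = u} \<le> degree P"
proof -
  have deg: "degree (P - [:u:]) = degree P"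
    unfolding diff_conv_add_uminus by (rule degree_add_eq_left) (use assms in simp)
  then have nz: "P - [:u:] \<noteq> 0" using assms by (metis degree_0 less_irrefl)
  have "card {x \<in> A. poly P x = u} \<le> card {x. poly (P - [:u:]) x = 0}"
    by (intro card_mono poly_roots_finite nz) auto
  also have "\<dots> \<le> degree P" using card_poly_roots_bound[OF nz] deg by simp
  finally show ?thesis .
qed

lemma galois_field_poly:
  "z \<in> galois_field k \<Longrightarrow> poly (map_poly to_ac P) z \<in> galois_field k"
  unfolding poly_altdef
  by (intro galois_field_sum galois_field_mult galois_field_power)
     (simp_all add: coeff_map_poly galois_field_to_ac)

text \<open>\<open>K >= 1\<close> excludes k = 0, where \<open>galois_field\<close> is the whole
  closure. The classes need only cover the field, not be disjoint.\<close>

theorem theorem1p19: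
  fixes P Q :: "'p::prime_card mod_ring poly" and r :: nat
  assumes "degree P > 0"
    and "good_for_irrational_equidistribution (map_poly (\<lambda>c. [:c:]) Q)"
  shows "\<exists>(K::nat) (c::real). K \<ge> 1 \<and> c > 0 \<and>
    (\<forall>k\<ge>K. \<forall>C :: nat \<Rightarrow> 'p mod_ring alg_closure set.
       galois_field k = (\<Union>i\<in>{1..r}. C i) \<longrightarrow>
       real (card {(x, y, z). x \<in> galois_field k \<and> y \<in> galois_field k \<and> z \<in> galois_field k \<and>
           poly (map_poly to_ac P) x - poly (map_poly to_ac P) y = poly (map_poly to_ac Q) z \<and>
           (\<exists>i\<in>{1..r}. {x, y, z} \<subseteq> C i)})
         \<ge> c * (real (CARD('p) ^ k))\<^sup>2)"
proof (cases "r = 0")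
  case True
  \<comment> \<open>Without colors nothing covers 0, so any K and c will do.\<close>
  then have "galois_field k \<noteq> (\<Union>i\<in>{1..r}. C i)" for k and C :: "nat \<Rightarrow> 'p mod_ring alg_closure set"
    using galois_field_zero by fastforce
  then show ?thesis by (metis le_refl zero_less_one)
next
  case False
  then have r: "r > 0" by simp
  define D where "D = degree P"
  define \<tau> where "\<tau> = color_threshold r (real D) r ^ (2 * r)"
  define c where "c = \<tau> / (4 * real r * real D ^ r)"
  have D: "real D \<ge> 1" using assms(1) by (simp add: D_def)
  have \<tau>: "\<tau> > 0" using color_threshold_bounds[OF r D, of r] by (simp add: \<tau>_def)
  then have c: "c > 0" using r D by (simp add: c_def)
  \<comment> \<open>A product of at most r counting functions has mass at most \<open>D^r\<close>,
    so its error is at most \<tau>/3, the amount the coloring argument tolerates.\<close>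
  define \<epsilon> where "\<epsilon> = \<tau> / (3 * real D ^ r)"
  have \<epsilon>: "\<epsilon> > 0" using \<tau> D by (simp add: \<epsilon>_def)
  let ?P = "map_poly to_ac P" and ?Q = "map_poly to_ac Q"
  obtain K where K: "K \<ge> 1" "\<forall>k\<ge>K. \<forall>b\<in>galois_field k - {0}.
      norm (\<Sum>z\<in>galois_field k. field_char k (b * poly ?Q z)) \<le> \<epsilon> * real (CARD('p) ^ k)"
    using good_exponential_sum_bound[OF assms(2) \<epsilon>] by blast
  show ?thesis
  proof (intro exI[of _ K] exI[of _ c] conjI allI impI K(1) c)
    fix k and C :: "nat \<Rightarrow> 'p mod_ring alg_closure set"
    assume kK: "K \<le> k" and cover: "galois_field k = (\<Union>i\<in>{1..r}. C i)"
    then have k: "k > 0" using K(1) by simp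
    let ?F = "galois_field k :: 'p mod_ring alg_closure set" and ?q = "real (CARD('p) ^ k)"
    have fin: "finite ?F" by (rule finite_galois_field[OF k])
    have cardF: "real (card ?F) = ?q" by (simp add: card_galois_field[OF k])
    have q: "?q > 0" using CARD_prime_pos[where 'p='p] by simp
    have degP: "degree ?P = D" by (simp add: D_def degree_map_poly)
    have fib: "card {x \<in> ?F. poly ?P x = u} \<le> D" for u
      using card_poly_fiber[of ?P ?F u] assms(1) degP by (simp add: D_def)
    \<comment> \<open>\<open>C i\<close> is arbitrary for i outside \<open>{1..r}\<close>;
      intersecting makes the bounds on \<open>G i\<close> hold for every index.\<close>
    define A where "A = (\<lambda>i. C i \<inter> ?F)"
    have A: "A i \<subseteq> ?F" for i by (auto simp: A_def)
    have AC: "A i = C i" if "i \<in> {1..r}" for i using that cover by (auto simp: A_def)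
    define G where "G = (\<lambda>i v. real (card {(x, y) \<in> A i \<times> A i. poly ?P x - poly ?P y = v}) / ?q)"
    have pd: "positive_definite k ((real (card (A i)) / ?q)\<^sup>2) (real D) (G i)" for i
      unfolding G_def by (intro positive_definite_differences[OF k A _ fib] galois_field_poly)
    have "\<exists>i\<in>{1..r}. (\<Sum>z\<in>A i. G i (poly ?Q z)) \<ge> real (card ?F) *
        (color_threshold r (real D) r ^ (2 * r) / (4 * real r * real D ^ r))"
    proof (rule monochromatic_return[OF r D fin])
      show "?F \<noteq> {}" using galois_field_zero by blast
      show "?F = (\<Union>i\<in>{1..r}. A i)" using cover AC by simp
      show "0 \<le> G i (poly ?Q z)" for i z by (simp add: G_def)
      show "G i (poly ?Q z) \<le> real D" for i z
      proof -
        have "real (card {(x, y) \<in> A i \<times> A i. poly ?P x - poly ?P y = poly ?Q z}) \<le> real D * ?q"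
          using card_difference_le[OF k A fib, of i "poly ?Q z"]
          by (simp only: of_nat_le_iff flip: of_nat_mult)
        then show ?thesis using q by (simp add: G_def divide_le_eq)
      qed
      fix S assume S: "S \<subseteq> {1..r}"
      have finS: "finite S" using S finite_subset by blast
      have "real D ^ card S \<le> real D ^ r"
        using D S card_mono[OF _ S] by (intro power_increasing) auto
      then have "\<epsilon> * real D ^ card S \<le> \<epsilon> * real D ^ r" using \<epsilon> by simp
      also have "\<dots> = \<tau> / 3" using D by (simp add: \<epsilon>_def)
      finally have "?q * ((\<Prod>i\<in>S. (real (card (A i)) / ?q)\<^sup>2) - \<tau> / 3) \<le>
          ?q * ((\<Prod>i\<in>S. (real (card (A i)) / ?q)\<^sup>2) - \<epsilon> * real D ^ card S)"
        using q by (intro mult_left_mono) auto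
      also have "\<dots> \<le> (\<Sum>z\<in>?F. \<Prod>i\<in>S. G i (poly ?Q z))"
        using K(2) kK \<epsilon>
        by (intro positive_definite_average[OF k positive_definite_prod[OF k finS pd]] galois_field_poly) auto
      finally show "real (card ?F) * ((\<Prod>i\<in>S. (real (card (A i)) / real (card ?F))\<^sup>2) -
          color_threshold r (real D) r ^ (2 * r) / 3) \<le> (\<Sum>z\<in>?F. \<Prod>i\<in>S. G i (poly ?Q z))"
        unfolding cardF \<tau>_def .
    qed
    then obtain i where i: "i \<in> {1..r}" "(\<Sum>z\<in>A i. G i (poly ?Q z)) \<ge> ?q * c"
      unfolding cardF c_def \<tau>_def by blast
    let ?R = "\<lambda>z. {(x, y) \<in> A i \<times> A i. poly ?P x - poly ?P y = poly ?Q z}"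
    let ?X = "{(x, y, z). x \<in> ?F \<and> y \<in> ?F \<and> z \<in> ?F \<and> poly ?P x - poly ?P y = poly ?Q z \<and>
           (\<exists>i\<in>{1..r}. {x, y, z} \<subseteq> C i)}"
    have finA: "finite (A i)" using A fin finite_subset by blast
    \<comment> \<open>One factor q comes from the sum over z, the other undoes the normalization of
      \<open>G\<close>; what remains counts triples fibered over z.\<close>
    have "c * ?q\<^sup>2 = ?q * (?q * c)" by (simp add: power2_eq_square)
    also have "\<dots> \<le> ?q * (\<Sum>z\<in>A i. G i (poly ?Q z))" using i(2) q by (intro mult_left_mono) auto
    also have "\<dots> = real (\<Sum>z\<in>A i. card (?R z))"
      using q by (simp add: G_def sum_distrib_left)
    also have "(\<Sum>z\<in>A i. card (?R z)) = card (SIGMA z:A i. ?R z)"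
      using finA by (intro card_SigmaI[symmetric]) (auto intro: finite_subset[of _ "A i \<times> A i"])
    also have "\<dots> = card ((\<lambda>(z, x, y). (x, y, z)) ` (SIGMA z:A i. ?R z))"
      by (intro card_image[symmetric]) (auto simp: inj_on_def)
    also have "real \<dots> \<le> real (card ?X)"
    proof -
      have "finite ?X" by (rule finite_subset[of _ "?F \<times> ?F \<times> ?F"]) (use fin in auto)
      moreover have "(\<lambda>(z, x, y). (x, y, z)) ` (SIGMA z:A i. ?R z) \<subseteq> ?X"
        using i(1) A[of i] AC[OF i(1)] by auto
      ultimately show ?thesis unfolding of_nat_le_iff by (rule card_mono)
    qed
    finally show "c * ?q\<^sup>2 \<le> real (card ?X)" .
  qed
qed

end
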